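(* For $d\in\mathbb{N}$ let $\delta_d=\frac1d$ and let $\lambda_d\in(0,\infty)$ be such that $\lim_{d\to\infty}\kappa_d^2\lambda_d^2\delta_d^d=\infty$. Let $\mathcal{E}_d$ be the number of edges, with midpoint in the unit ball $\mathbb{B}^d$, of the random geometric graph with distance parameter $\delta_d$ built on a stationary Poisson point process in $\mathbb{R}^d$ of intensity $\lambda_d$. Then $$ \mathbb{E}[\mathcal{E}_d]=\frac12\,\kappa_d^2\,\lambda_d^2\,\delta_d^d $$ and $$ \frac12\kappa_d^2\lambda_d^2\delta_d^d+\Big(1-\tfrac{\delta_d}{2}\Big)^d\kappa_d^3\lambda_d^3\delta_d^{2d}\leq\operatorname{Var}[\mathcal{E}_d]\leq\frac12\kappa_d^2\lambda_d^2\delta_d^d+\Big(1+\tfrac{\delta_d}{2}\Big)^d\kappa_d^3\lambda_d^3\delta_d^{2d}. $$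
   Context: $\mathbb{B}^d$ is the closed Euclidean unit ball in $\mathbb{R}^d$ centred at the origin and $\kappa_d=\pi^{d/2}/\Gamma(1+d/2)$ is its volume. A stationary Poisson point process $\eta_{\lambda}$ on $\mathbb{R}^d$ of intensity $\lambda\in(0,\infty)$ is a Poisson point process whose intensity measure is $\lambda$ times Lebesgue measure. The edge counting statistic is $$ \mathcal{E}_d:=\frac12\sum_{\substack{x,y\in\eta_{\lambda_d}\\ x\neq y}}\mathbf{1}\Big\{\|x-y\|\leq\delta_d,\ \frac{x+y}{2}\in\mathbb{B}^d\Big\}, $$ with $\|\cdot\|$ the Euclidean norm. *)

theory Defs
  imports "HOL-Probability.Probability"
begin

definition point_count :: "('w \<Rightarrow> 'a set) \<Rightarrow> 'a set \<Rightarrow> 'w \<Rightarrow> ennreal" where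
  "point_count \<eta> B \<omega> = emeasure (count_space UNIV) (\<eta> \<omega> \<inter> B)"

text \<open>A Poisson process is modelled as a random locally finite set of points, i.e. a simple
  point process is identified with its support. This is the right notion for intensity measures
  without atoms, such as multiples of Lebesgue measure; for a measure with atoms no such random
  set exists. As usual, a Poisson variable with infinite mean is almost surely infinite.\<close>

definition poisson_process ::
    "'w measure \<Rightarrow> 'a::euclidean_space measure \<Rightarrow> ('w \<Rightarrow> 'a set) \<Rightarrow> bool" where
  "poisson_process M \<mu> \<eta> \<longleftrightarrow>
     prob_space M \<and>
     (\<forall>\<omega>\<in>space M. \<forall>B. bounded B \<longrightarrow> finite (\<eta> \<omega> \<inter> B)) \<and>
     (\<forall>B\<in>sets borel. point_count \<eta> B \<in> borel_measurable M) \<and>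
     (\<forall>B\<in>sets borel. emeasure \<mu> B < \<infinity> \<longrightarrow>
        (\<forall>k::nat. measure M {\<omega>\<in>space M. point_count \<eta> B \<omega> = of_nat k}
                   = exp (- measure \<mu> B) * measure \<mu> B ^ k / fact k)) \<and>
     (\<forall>B\<in>sets borel. emeasure \<mu> B = \<infinity> \<longrightarrow> (AE \<omega> in M. point_count \<eta> B \<omega> = \<infinity>)) \<and>
     (\<forall>(A :: nat \<Rightarrow> 'a set) m. (\<forall>i<m. A i \<in> sets borel) \<longrightarrow> disjoint_family_on A {..<m} \<longrightarrow>
        prob_space.indep_vars M (\<lambda>_. borel) (\<lambda>i. point_count \<eta> (A i)) {..<m})"

definition stationary_poisson_process ::
    "'w measure \<Rightarrow> real \<Rightarrow> ('w \<Rightarrow> 'a::euclidean_space set) \<Rightarrow> bool" where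
  "stationary_poisson_process M l \<eta> \<longleftrightarrow> poisson_process M (scale_measure (ennreal l) lborel) \<eta>"

text \<open>For a locally finite set only finitely many terms of the following sum are nonzero.\<close>

definition edge_count :: "real \<Rightarrow> 'a::euclidean_space set \<Rightarrow> real" where
  "edge_count \<delta> X = 1/2 * (\<Sum>\<^sub>\<infinity>(x, y) \<in> {(x, y). x \<in> X \<and> y \<in> X \<and> x \<noteq> y}.
      of_bool (norm (x - y) \<le> \<delta> \<and> (x + y) /\<^sub>R 2 \<in> cball 0 1))"

end

theory Submission
  imports Defs
begin

text \<open>Partition a compact neighbourhood of the unit ball into finitely many small cells. Counting
  pairs of points in distinct cells that contain the endpoints of some admissible edge gives a
  quadratic form with zero diagonal in independent Poisson variables. Centring these variables
  yields its mean and variance exactly. As the cells shrink, dominated convergence (the dominating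
  variable is a power of the number of points in the neighbourhood) gives
  \<open>E = \<integral>g / 2\<close> and \<open>Var = \<integral>g / 2 + \<integral>g\<^sup>2\<close>, where \<open>g x\<close> is the intensity of the neighbours of a point
  \<open>x\<close>. The first integral is explicit in the coordinates midpoint and difference; for the second,
  \<open>g\<close> is constant on the ball of radius \<open>1 - \<delta> / 2\<close>, bounded by that constant everywhere, and zero
  outside the ball of radius \<open>1 + \<delta> / 2\<close>.\<close>

subsection \<open>Poisson moments\<close>

text \<open>The law of \<open>N\<close> has density \<open>p\<close> with respect to counting
  measure, so the expectation is a series. As its terms are nonnegative, convergence is absolute,
  which is what Bochner integrability on \<open>nat\<close> requires.\<close>

lemma has_bochner_integral_nat_valued:
  fixes N :: "'w \<Rightarrow> nat" and f :: "nat \<Rightarrow> real"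
  assumes M: "prob_space M" and N: "N \<in> M \<rightarrow>\<^sub>M count_space UNIV"
    and p: "\<And>k. measure M {\<omega>\<in>space M. N \<omega> = k} = p k"
    and pos: "\<And>k. 0 \<le> f k" and s: "(\<lambda>k. p k * f k) sums s"
  shows "has_bochner_integral M (\<lambda>\<omega>. f (N \<omega>)) s"
proof -
  interpret prob_space M by (fact M)
  have p0: "0 \<le> p k" for k using p[of k] by (metis measure_nonneg)
  have D: "distr M (count_space UNIV) N = density (count_space UNIV) (\<lambda>k. ennreal (p k))"
  proof (rule measure_eqI_countable[of _ UNIV])
    fix k
    have "emeasure (distr M (count_space UNIV) N) {k} = emeasure M {\<omega>\<in>space M. N \<omega> = k}"
      using N by (subst emeasure_distr) (auto intro!: arg_cong[of _ _ "emeasure M"])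
    thus "emeasure (distr M (count_space UNIV) N) {k}
        = emeasure (density (count_space UNIV) (\<lambda>k. ennreal (p k))) {k}"
      by (simp add: emeasure_eq_measure p emeasure_density)
  qed auto
  have ps: "summable (\<lambda>k. norm (p k * f k))"
    using s p0 pos by (simp add: sums_iff)
  have "has_bochner_integral (distr M (count_space UNIV) N) f s"
    unfolding D
  proof (rule has_bochner_integral_density)
    show "has_bochner_integral (count_space UNIV) (\<lambda>k. p k *\<^sub>R f k) s"
      using ps s
      by (simp add: has_bochner_integral_iff integrable_count_space_nat_iff integral_count_space_nat sums_iff)
  qed (use p0 in auto)
  thus ?thesis
    using N by (auto simp: has_bochner_integral_iff integrable_distr_eq integral_distr)
qed

text \<open>The recursion \<open>p (Suc k) * real (Suc k) = m * p k\<close> lowers the degree of the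
  polynomial weight by one after an index shift; the term lost in the shift vanishes at
  \<open>k = 0\<close>. The third sum is the exponential series at \<open>m * exp 1\<close>; it
  serves to control all higher moments.\<close>

lemma poisson_sums:
  fixes m :: real
  defines "p \<equiv> \<lambda>k. exp (- m) * m ^ k / fact k"
  shows "(\<lambda>k. p k * real k) sums m" and "(\<lambda>k. p k * (real k)\<^sup>2) sums (m\<^sup>2 + m)"
    and "(\<lambda>k. p k * exp (real k)) sums exp (m * exp 1 - m)"
proof -
  have exp: "(\<lambda>k. exp (- m) * (x ^ k / fact k)) sums (exp (- m) * exp x)" for x
    using exp_converges[of x] by (intro sums_mult) (simp add: divide_inverse mult.commute)
  have one: "p sums 1" using exp[of m] by (simp add: p_def exp_minus)
  have step: "p (Suc k) * real (Suc k) = m * p k" for k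
    by (simp add: p_def field_simps del: of_nat_Suc)
  have "(\<lambda>k. p (Suc k) * real (Suc k)) sums m"
    unfolding step using sums_mult[OF one, of m] by simp
  from sums_Suc_imp[OF _ this] show 1: "(\<lambda>k. p k * real k) sums m" by simp
  have "(\<lambda>k. p (Suc k) * (real (Suc k))\<^sup>2) = (\<lambda>k. m * (p k * real k) + m * p k)"
  proof
    fix k
    have "p (Suc k) * (real (Suc k))\<^sup>2 = p (Suc k) * real (Suc k) * real (Suc k)"
      by (simp only: power2_eq_square mult.assoc)
    also have "\<dots> = m * p k * (real k + 1)" unfolding step by simp
    finally show "p (Suc k) * (real (Suc k))\<^sup>2 = m * (p k * real k) + m * p k"
      by (simp add: algebra_simps)
  qed
  moreover have "(\<lambda>k. m * (p k * real k) + m * p k) sums (m * m + m * 1)"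
    by (intro sums_add sums_mult 1 one)
  ultimately have "(\<lambda>k. p (Suc k) * (real (Suc k))\<^sup>2) sums (m\<^sup>2 + m)"
    by (simp add: power2_eq_square)
  from sums_Suc_imp[OF _ this] show "(\<lambda>k. p k * (real k)\<^sup>2) sums (m\<^sup>2 + m)" by simp
  have "(\<lambda>k. p k * exp (real k)) = (\<lambda>k. exp (- m) * ((m * exp 1) ^ k / fact k))"
    by (simp add: p_def power_mult_distrib mult.assoc flip: exp_of_nat_mult)
  thus "(\<lambda>k. p k * exp (real k)) sums exp (m * exp 1 - m)"
    using exp[of "m * exp 1"] by (simp flip: exp_add)
qed

lemma poisson_moments:
  fixes N :: "'w \<Rightarrow> nat" and m :: real
  assumes M: "prob_space M" and N: "N \<in> M \<rightarrow>\<^sub>M count_space UNIV"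
    and p: "\<And>k. measure M {\<omega>\<in>space M. N \<omega> = k} = exp (- m) * m ^ k / fact k"
  shows "integrable M (\<lambda>\<omega>. real (N \<omega>) ^ r)"
    and "prob_space.expectation M (\<lambda>\<omega>. real (N \<omega>)) = m"
    and "prob_space.variance M (\<lambda>\<omega>. real (N \<omega>)) = m"
proof -
  interpret prob_space M by (fact M)
  note h = has_bochner_integral_nat_valued[OF M N p]
  have 1: "has_bochner_integral M (\<lambda>\<omega>. real (N \<omega>)) m"
    using h[of real, OF _ poisson_sums(1)] by simp
  have 2: "has_bochner_integral M (\<lambda>\<omega>. (real (N \<omega>))\<^sup>2) (m\<^sup>2 + m)"
    using h[of "\<lambda>k. (real k)\<^sup>2", OF _ poisson_sums(2)] by simp
  have 3: "has_bochner_integral M (\<lambda>\<omega>. exp (real (N \<omega>))) (exp (m * exp 1 - m))"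
    using h[of "\<lambda>k. exp (real k)", OF _ poisson_sums(3)] by simp
  \<comment> \<open>One term of the exponential series is at most the whole series, so the
    exponential moment dominates every power.\<close>
  have le: "x ^ r \<le> fact r * exp x" if "0 \<le> x" for x :: real
  proof -
    have "(\<Sum>k\<in>{r}. x ^ k / fact k) \<le> (\<Sum>k. x ^ k / fact k)"
      using that by (intro sum_le_suminf)
        (auto intro: sums_summable[OF exp_converges[of x, unfolded divide_inverse_commute[symmetric] real_scaleR_def]])
    also have "\<dots> = exp x" by (simp add: exp_def divide_inverse mult.commute)
    finally show ?thesis by (simp add: field_simps)
  qed
  show "integrable M (\<lambda>\<omega>. real (N \<omega>) ^ r)"
  proof (rule Bochner_Integration.integrable_bound)
    show "integrable M (\<lambda>\<omega>. fact r * exp (real (N \<omega>)))" using 3 by (simp add: has_bochner_integral_iff)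
    show "(\<lambda>\<omega>. real (N \<omega>) ^ r) \<in> borel_measurable M" using N by measurable
  qed (use le in auto)
  show E: "expectation (\<lambda>\<omega>. real (N \<omega>)) = m" using 1 by (simp add: has_bochner_integral_iff)
  show "variance (\<lambda>\<omega>. real (N \<omega>)) = m"
    using 1 2 by (subst variance_eq) (auto simp: has_bochner_integral_iff)
qed

subsection \<open>Quadratic forms in independent variables\<close>

text \<open>Monomials in the variables are encoded as lists of indices. Grouping equal indices turns
  them into products over distinct indices, the form in which independence applies.\<close>

lemma prod_list_eq_prod_count_list:
  fixes f :: "'i \<Rightarrow> 'b::comm_monoid_mult"
  assumes "finite I" "set L \<subseteq> I"
  shows "(\<Prod>l\<leftarrow>L. f l) = (\<Prod>i\<in>I. f i ^ count_list L i)"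
  using assms(2)
proof (induction L)
  case (Cons k L)
  have "(\<Prod>i\<in>I. f i ^ count_list (k # L) i)
      = (\<Prod>i\<in>I. (if i = k then f i else 1) * f i ^ count_list L i)"
    by (intro prod.cong) auto
  also have "\<dots> = f k * (\<Prod>i\<in>I. f i ^ count_list L i)"
    using Cons.prems assms(1) by (simp add: prod.distrib)
  finally show ?case using Cons by simp
qed simp

context prob_space
begin

text \<open>With every multiplicity at most 2, second moments suffice for each factor to be
  integrable; independence then factors the expectation.\<close>

lemma indep_vars_prod_list_moment:
  fixes Y :: "'i \<Rightarrow> 'a \<Rightarrow> real"
  assumes fin: "finite I" and ind: "indep_vars (\<lambda>_. borel) Y I"
    and sq: "\<And>i. i \<in> I \<Longrightarrow> integrable M (\<lambda>\<omega>. (Y i \<omega>)\<^sup>2)"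
    and L: "set L \<subseteq> I" "\<And>i. i \<in> I \<Longrightarrow> count_list L i \<le> 2"
  shows "integrable M (\<lambda>\<omega>. \<Prod>l\<leftarrow>L. Y l \<omega>)"
    and "expectation (\<lambda>\<omega>. \<Prod>l\<leftarrow>L. Y l \<omega>) = (\<Prod>i\<in>I. expectation (\<lambda>\<omega>. Y i \<omega> ^ count_list L i))"
proof -
  let ?Z = "\<lambda>i \<omega>. Y i \<omega> ^ count_list L i"
  have Z: "indep_vars (\<lambda>_. borel) ?Z I"
    by (rule indep_vars_compose2[OF ind, of "\<lambda>i y. y ^ count_list L i"]) simp
  have int: "integrable M (?Z i)" if "i \<in> I" for i
  proof -
    have "Y i \<in> borel_measurable M" using ind that by (auto simp: indep_vars_def)
    hence "integrable M (Y i)" using sq[OF that] square_integrable_imp_integrable by blast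
    moreover have "count_list L i = 0 \<or> count_list L i = 1 \<or> count_list L i = 2"
      using L(2)[OF that] by linarith
    ultimately show ?thesis using sq[OF that] by auto
  qed
  have eq: "(\<lambda>\<omega>. \<Prod>l\<leftarrow>L. Y l \<omega>) = (\<lambda>\<omega>. \<Prod>i\<in>I. ?Z i \<omega>)"
    using prod_list_eq_prod_count_list[OF fin L(1)] by blast
  show "integrable M (\<lambda>\<omega>. \<Prod>l\<leftarrow>L. Y l \<omega>)"
    unfolding eq by (rule indep_vars_integrable[OF fin Z int])
  show "expectation (\<lambda>\<omega>. \<Prod>l\<leftarrow>L. Y l \<omega>) = (\<Prod>i\<in>I. expectation (\<lambda>\<omega>. Y i \<omega> ^ count_list L i))"
    unfolding eq by (rule indep_vars_lebesgue_integral[OF fin Z int])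
qed

text \<open>Expand the square into monomials. The zero diagonal forces distinct indices within each
  pair, so no index occurs more than twice, and a monomial with an index occurring once has mean
  zero. In degree four only \<open>(k, l) = (i, j)\<close> and \<open>(k, l) = (j, i)\<close>
  survive, whence the factor 2.\<close>

lemma expectation_quadratic_form_centered:
  fixes Y :: "'i \<Rightarrow> 'a \<Rightarrow> real" and a :: "'i \<Rightarrow> 'i \<Rightarrow> real" and c v :: "'i \<Rightarrow> real"
  assumes fin: "finite I" and ind: "indep_vars (\<lambda>_. borel) Y I"
    and sq: "\<And>i. i \<in> I \<Longrightarrow> integrable M (\<lambda>\<omega>. (Y i \<omega>)\<^sup>2)"
    and mean: "\<And>i. i \<in> I \<Longrightarrow> expectation (Y i) = 0"
    and var: "\<And>i. i \<in> I \<Longrightarrow> expectation (\<lambda>\<omega>. (Y i \<omega>)\<^sup>2) = v i"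
    and sym: "\<And>i j. a i j = a j i" and diag: "\<And>i. a i i = 0"
  defines "F \<equiv> \<lambda>\<omega>. (\<Sum>i\<in>I. \<Sum>j\<in>I. a i j * Y i \<omega> * Y j \<omega>) + (\<Sum>i\<in>I. c i * Y i \<omega>)"
  shows "integrable M F" and "integrable M (\<lambda>\<omega>. (F \<omega>)\<^sup>2)" and "expectation F = 0"
    and "expectation (\<lambda>\<omega>. (F \<omega>)\<^sup>2)
           = 2 * (\<Sum>i\<in>I. \<Sum>j\<in>I. (a i j)\<^sup>2 * v i * v j) + (\<Sum>i\<in>I. (c i)\<^sup>2 * v i)"
proof -
  note mom = indep_vars_prod_list_moment[OF fin ind sq]
  have zero: "expectation (\<lambda>\<omega>. \<Prod>l\<leftarrow>L. Y l \<omega>) = 0"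
    if "set L \<subseteq> I" "\<And>i. i \<in> I \<Longrightarrow> count_list L i \<le> 2" "q \<in> I" "count_list L q = 1" for L q
    unfolding mom(2)[OF _ that(1,2), simplified]
    using that(3,4) mean[OF that(3)] fin by (intro prod_zero) (auto intro!: bexI[of _ q])
  have i1: "integrable M (Y i)" and e1: "expectation (Y i) = 0" if "i \<in> I" for i
    using mom(1)[of "[i]"] mean that by auto
  have i2: "integrable M (\<lambda>\<omega>. Y i \<omega> * Y j \<omega>)" if "i \<in> I" "j \<in> I" for i j
    using mom(1)[of "[i,j]"] that by auto
  have e2: "expectation (\<lambda>\<omega>. Y i \<omega> * Y j \<omega>) = (if i = j then v i else 0)"
    if "i \<in> I" "j \<in> I" for i j
    using zero[of "[i,j]" i] var[of i] that by (auto simp: power2_eq_square)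
  have c3: "count_list [i,j,k] q \<le> 2" if "i \<noteq> j" for i j k q
    using that by auto
  have c4: "count_list [i,j,k,l] q \<le> 2" if "i \<noteq> j" "k \<noteq> l" for i j k l q
    using that by auto
  have i3: "integrable M (\<lambda>\<omega>. Y i \<omega> * Y j \<omega> * Y k \<omega>)" if "i \<in> I" "j \<in> I" "k \<in> I" "i \<noteq> j" for i j k
    using mom(1)[of "[i,j,k]", OF _ _ c3] that by (simp add: mult.assoc)
  \<comment> \<open>Some index occurs exactly once: it is \<open>j\<close> if \<open>k = i\<close>,
    and \<open>i\<close> otherwise.\<close>
  have e3: "expectation (\<lambda>\<omega>. Y i \<omega> * Y j \<omega> * Y k \<omega>) = 0"
    if "i \<in> I" "j \<in> I" "k \<in> I" "i \<noteq> j" for i j k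
    using zero[of "[i,j,k]" "if k = i then j else i", OF _ c3] that
    by (cases "k = i") (auto simp: mult.assoc)
  have i4: "integrable M (\<lambda>\<omega>. Y i \<omega> * Y j \<omega> * (Y k \<omega> * Y l \<omega>))"
    if "i \<in> I" "j \<in> I" "k \<in> I" "l \<in> I" "i \<noteq> j" "k \<noteq> l" for i j k l
    using mom(1)[of "[i,j,k,l]", OF _ _ c4] that by (simp add: mult.assoc)
  have sqprod: "expectation (\<lambda>\<omega>. Y i \<omega> * (Y j \<omega> * (Y i \<omega> * Y j \<omega>))) = v i * v j"
    if "i \<in> I" "j \<in> I" "i \<noteq> j" for i j
  proof -
    have "expectation (\<lambda>\<omega>. Y i \<omega> * (Y j \<omega> * (Y i \<omega> * Y j \<omega>)))
        = (\<Prod>q\<in>I. expectation (\<lambda>\<omega>. Y q \<omega> ^ count_list [i,j,i,j] q))"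
      using mom(2)[of "[i,j,i,j]", OF _ _ c4] that by simp
    also have "\<dots> = (\<Prod>q\<in>I. (if q = i then v q else 1) * (if q = j then v q else 1))"
      using that var by (intro prod.cong) (auto simp: prob_space numeral_2_eq_2)
    also have "\<dots> = v i * v j" using fin that by (simp add: prod.distrib)
    finally show ?thesis .
  qed
  \<comment> \<open>an index occurring once contributes a vanishing mean, so \<open>{k, l} = {i, j}\<close> is the only surviving case\<close>
  have e4: "expectation (\<lambda>\<omega>. Y i \<omega> * Y j \<omega> * (Y k \<omega> * Y l \<omega>))
      = (if k = i \<and> l = j then v i * v j else 0) + (if k = j \<and> l = i then v i * v j else 0)"
    if idx: "i \<in> I" "j \<in> I" "k \<in> I" "l \<in> I" "i \<noteq> j" "k \<noteq> l" for i j k l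
  proof -
    consider "k = i" "l = j" | "k = j" "l = i" | "i \<noteq> k" "i \<noteq> l" | "j \<noteq> k" "j \<noteq> l"
      using idx by metis
    then show ?thesis
    proof cases
      case 1 thus ?thesis using sqprod[of i j] idx by (simp add: mult.assoc)
    next
      case 2 thus ?thesis using sqprod[of i j] idx by (simp add: mult_ac)
    next
      case 3 thus ?thesis using zero[of "[i,j,k,l]" i, OF _ c4] idx by (auto simp: mult.assoc)
    next
      case 4 thus ?thesis using zero[of "[i,j,k,l]" j, OF _ c4] idx by (auto simp: mult.assoc)
    qed
  qed
  \<comment> \<open>The square of \<open>Q + K\<close> has parts of degree 4, 3 and 2. The cubic
    part has mean zero, so the quadratic and the linear form contribute to the second moment
    separately.\<close>
  define Q where "Q = (\<lambda>\<omega>. \<Sum>i\<in>I. \<Sum>j\<in>I. a i j * (Y i \<omega> * Y j \<omega>))"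
  define K where "K = (\<lambda>\<omega>. \<Sum>i\<in>I. c i * Y i \<omega>)"
  have F: "F = (\<lambda>\<omega>. Q \<omega> + K \<omega>)" by (simp add: F_def Q_def K_def mult.assoc)
  have iQ: "integrable M Q" unfolding Q_def by (intro Bochner_Integration.integrable_sum) (auto intro: i2)
  have iK: "integrable M K" unfolding K_def by (intro Bochner_Integration.integrable_sum) (auto intro: i1)
  show "integrable M F" unfolding F by (intro Bochner_Integration.integrable_add iQ iK)
  have eQ: "expectation Q = 0"
  proof -
    have "expectation Q = (\<Sum>i\<in>I. \<Sum>j\<in>I. a i j * expectation (\<lambda>\<omega>. Y i \<omega> * Y j \<omega>))"
      unfolding Q_def by (simp add: i2)
    thus ?thesis by (simp add: e2 diag if_distrib[of "\<lambda>x. _ * x"] cong: if_cong)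
  qed
  have eK: "expectation K = 0" unfolding K_def
    by (subst Bochner_Integration.integral_sum | simp add: i1 e1)+
  show "expectation F = 0" unfolding F using iQ iK eQ eK by simp
  have KK: "(\<lambda>\<omega>. K \<omega> * K \<omega>) = (\<lambda>\<omega>. \<Sum>i\<in>I. \<Sum>j\<in>I. c i * c j * (Y i \<omega> * Y j \<omega>))"
    unfolding K_def by (simp add: sum_product mult_ac)
  have iKK: "integrable M (\<lambda>\<omega>. K \<omega> * K \<omega>)"
    unfolding KK by (intro Bochner_Integration.integrable_sum) (auto intro: i2)
  have eKK: "expectation (\<lambda>\<omega>. K \<omega> * K \<omega>) = (\<Sum>i\<in>I. (c i)\<^sup>2 * v i)"
  proof -
    have "expectation (\<lambda>\<omega>. K \<omega> * K \<omega>) = (\<Sum>i\<in>I. \<Sum>j\<in>I. c i * c j * (if i = j then v i else 0))"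
      unfolding KK by (simp add: i2 e2)
    also have "\<dots> = (\<Sum>i\<in>I. \<Sum>j\<in>I. if i = j then (c i)\<^sup>2 * v i else 0)"
      by (intro sum.cong) (auto simp: power2_eq_square)
    finally show ?thesis using fin by simp
  qed
  have QK: "(\<lambda>\<omega>. Q \<omega> * K \<omega>)
      = (\<lambda>\<omega>. \<Sum>i\<in>I. \<Sum>j\<in>I. \<Sum>k\<in>I. a i j * c k * (Y i \<omega> * Y j \<omega> * Y k \<omega>))"
    unfolding Q_def K_def by (simp add: sum_distrib_left sum_distrib_right mult_ac)
  \<comment> \<open>With the coefficient included, the case \<open>i = j\<close> is trivial, so the
    formulas hold for all indices and can be summed over \<open>I\<close> without
    restriction.\<close>
  have i3': "integrable M (\<lambda>\<omega>. a i j * c k * (Y i \<omega> * Y j \<omega> * Y k \<omega>))"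
    and e3': "expectation (\<lambda>\<omega>. a i j * c k * (Y i \<omega> * Y j \<omega> * Y k \<omega>)) = 0"
    if "i \<in> I" "j \<in> I" "k \<in> I" for i j k
    by (cases "i = j"; use diag i3[of i j k] e3[of i j k] that in auto)+
  have iQK: "integrable M (\<lambda>\<omega>. Q \<omega> * K \<omega>)"
    unfolding QK by (intro Bochner_Integration.integrable_sum i3')
  have eQK: "expectation (\<lambda>\<omega>. Q \<omega> * K \<omega>) = 0"
  proof -
    have "expectation (\<lambda>\<omega>. Q \<omega> * K \<omega>)
        = (\<Sum>i\<in>I. \<Sum>j\<in>I. \<Sum>k\<in>I. expectation (\<lambda>\<omega>. a i j * c k * (Y i \<omega> * Y j \<omega> * Y k \<omega>)))"
      unfolding QK
      by ((rule trans[OF Bochner_Integration.integral_sum],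
            (intro Bochner_Integration.integrable_sum i3'; assumption), rule sum.cong[OF refl])+,
          rule refl)
    thus ?thesis by (simp add: e3' del: integral_mult_right_zero integral_mult_left_zero)
  qed
  have QQ: "(\<lambda>\<omega>. Q \<omega> * Q \<omega>) = (\<lambda>\<omega>. \<Sum>i\<in>I. \<Sum>j\<in>I. \<Sum>k\<in>I. \<Sum>l\<in>I.
      a i j * a k l * (Y i \<omega> * Y j \<omega> * (Y k \<omega> * Y l \<omega>)))"
    unfolding Q_def sum_distrib_right unfolding sum_distrib_left by (simp add: mult_ac)
  \<comment> \<open>Symmetry of \<open>a\<close> makes both surviving pairings carry the same
    coefficient \<open>(a i j)\<^sup>2\<close>. The nested conditionals let the sums over
    \<open>l\<close> and \<open>k\<close> collapse one after the other.\<close>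
  have i4': "integrable M (\<lambda>\<omega>. a i j * a k l * (Y i \<omega> * Y j \<omega> * (Y k \<omega> * Y l \<omega>)))"
    and e4': "expectation (\<lambda>\<omega>. a i j * a k l * (Y i \<omega> * Y j \<omega> * (Y k \<omega> * Y l \<omega>)))
      = (if k = i then if l = j then (a i j)\<^sup>2 * v i * v j else 0 else 0)
        + (if k = j then if l = i then (a i j)\<^sup>2 * v i * v j else 0 else 0)"
    if "i \<in> I" "j \<in> I" "k \<in> I" "l \<in> I" for i j k l
  proof -
    have "i \<noteq> j \<and> k \<noteq> l \<or> i = j \<or> k = l" by blast
    then show "integrable M (\<lambda>\<omega>. a i j * a k l * (Y i \<omega> * Y j \<omega> * (Y k \<omega> * Y l \<omega>)))"
      using diag i4[of i j k l] that by auto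
    show "expectation (\<lambda>\<omega>. a i j * a k l * (Y i \<omega> * Y j \<omega> * (Y k \<omega> * Y l \<omega>)))
      = (if k = i then if l = j then (a i j)\<^sup>2 * v i * v j else 0 else 0)
        + (if k = j then if l = i then (a i j)\<^sup>2 * v i * v j else 0 else 0)"
    proof (cases "i = j \<or> k = l")
      case True
      thus ?thesis using diag by auto
    next
      case False
      hence "expectation (\<lambda>\<omega>. a i j * a k l * (Y i \<omega> * Y j \<omega> * (Y k \<omega> * Y l \<omega>)))
        = a i j * a k l * ((if k = i \<and> l = j then v i * v j else 0)
            + (if k = j \<and> l = i then v i * v j else 0))"
        using e4[of i j k l] that by simp
      thus ?thesis using sym[of i j] False by (auto simp: power2_eq_square)
    qed
  qed
  have iQQ: "integrable M (\<lambda>\<omega>. Q \<omega> * Q \<omega>)"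
    unfolding QQ by (intro Bochner_Integration.integrable_sum i4')
  have eQQ: "expectation (\<lambda>\<omega>. Q \<omega> * Q \<omega>) = 2 * (\<Sum>i\<in>I. \<Sum>j\<in>I. (a i j)\<^sup>2 * v i * v j)"
  proof -
    have "expectation (\<lambda>\<omega>. Q \<omega> * Q \<omega>) = (\<Sum>i\<in>I. \<Sum>j\<in>I. \<Sum>k\<in>I. \<Sum>l\<in>I.
        expectation (\<lambda>\<omega>. a i j * a k l * (Y i \<omega> * Y j \<omega> * (Y k \<omega> * Y l \<omega>))))"
      unfolding QQ
      by ((rule trans[OF Bochner_Integration.integral_sum],
            (intro Bochner_Integration.integrable_sum i4'; assumption), rule sum.cong[OF refl])+,
          rule refl)
    also have "\<dots> = (\<Sum>i\<in>I. \<Sum>j\<in>I. \<Sum>k\<in>I. \<Sum>l\<in>I.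
        (if k = i then if l = j then (a i j)\<^sup>2 * v i * v j else 0 else 0)
        + (if k = j then if l = i then (a i j)\<^sup>2 * v i * v j else 0 else 0))"
      by (intro sum.cong refl e4')
    also have "\<dots> = (\<Sum>i\<in>I. \<Sum>j\<in>I. 2 * ((a i j)\<^sup>2 * v i * v j))"
    proof (intro sum.cong refl)
      fix i j assume "i \<in> I" "j \<in> I"
      have "(\<Sum>k\<in>I. \<Sum>l\<in>I. if k = p then if l = q then z else 0 else 0) = z"
        if "p \<in> I" "q \<in> I" for p q and z :: real
      proof -
        have "(\<Sum>k\<in>I. \<Sum>l\<in>I. if k = p then if l = q then z else 0 else 0)
            = (\<Sum>k\<in>I. if k = p then \<Sum>l\<in>I. if l = q then z else 0 else 0)"
          by (intro sum.cong) auto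
        thus ?thesis using fin that by simp
      qed
      thus "(\<Sum>k\<in>I. \<Sum>l\<in>I.
        (if k = i then if l = j then (a i j)\<^sup>2 * v i * v j else 0 else 0)
        + (if k = j then if l = i then (a i j)\<^sup>2 * v i * v j else 0 else 0))
          = 2 * ((a i j)\<^sup>2 * v i * v j)"
        using \<open>i \<in> I\<close> \<open>j \<in> I\<close> by (simp add: sum.distrib)
    qed
    finally show ?thesis by (simp add: sum_distrib_left)
  qed
  have F2: "(\<lambda>\<omega>. (F \<omega>)\<^sup>2) = (\<lambda>\<omega>. Q \<omega> * Q \<omega> + 2 * (Q \<omega> * K \<omega>) + K \<omega> * K \<omega>)"
    unfolding F by (simp add: power2_eq_square algebra_simps)
  show "integrable M (\<lambda>\<omega>. (F \<omega>)\<^sup>2)" unfolding F2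
    by (intro Bochner_Integration.integrable_add integrable_mult_right iQQ iQK iKK)
  show "expectation (\<lambda>\<omega>. (F \<omega>)\<^sup>2)
      = 2 * (\<Sum>i\<in>I. \<Sum>j\<in>I. (a i j)\<^sup>2 * v i * v j) + (\<Sum>i\<in>I. (c i)\<^sup>2 * v i)"
    unfolding F2 by (simp add: iQQ iQK iKK eQQ eQK eKK)
qed

text \<open>Substituting \<open>X i = Y i + m i\<close> leaves a centred quadratic form, a linear
  form and the constant \<open>e\<close>. By symmetry the two cross terms agree, so the linear
  coefficient is \<open>c i = 2 * (\<Sum>j\<in>I. a i j * m j)\<close>; its square produces the
  factor 4.\<close>

lemma moments_quadratic_form:
  fixes X :: "'i \<Rightarrow> 'a \<Rightarrow> real" and a :: "'i \<Rightarrow> 'i \<Rightarrow> real" and m v :: "'i \<Rightarrow> real"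
  assumes fin: "finite I" and ind: "indep_vars (\<lambda>_. borel) X I"
    and sq: "\<And>i. i \<in> I \<Longrightarrow> integrable M (\<lambda>\<omega>. (X i \<omega>)\<^sup>2)"
    and mean: "\<And>i. i \<in> I \<Longrightarrow> expectation (X i) = m i"
    and var: "\<And>i. i \<in> I \<Longrightarrow> variance (X i) = v i"
    and sym: "\<And>i j. a i j = a j i" and diag: "\<And>i. a i i = 0"
  defines "N \<equiv> \<lambda>\<omega>. \<Sum>i\<in>I. \<Sum>j\<in>I. a i j * X i \<omega> * X j \<omega>"
  shows "integrable M N"
    and "integrable M (\<lambda>\<omega>. (N \<omega>)\<^sup>2)"
    and "expectation N = (\<Sum>i\<in>I. \<Sum>j\<in>I. a i j * m i * m j)"
    and "variance N = 2 * (\<Sum>i\<in>I. \<Sum>j\<in>I. (a i j)\<^sup>2 * v i * v j)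
           + 4 * (\<Sum>i\<in>I. (\<Sum>j\<in>I. a i j * m j)\<^sup>2 * v i)"
proof -
  define Y where "Y = (\<lambda>i \<omega>. X i \<omega> - m i)"
  define c where "c = (\<lambda>i. 2 * (\<Sum>j\<in>I. a i j * m j))"
  define e where "e = (\<Sum>i\<in>I. \<Sum>j\<in>I. a i j * m i * m j)"
  define F where "F = (\<lambda>\<omega>. (\<Sum>i\<in>I. \<Sum>j\<in>I. a i j * Y i \<omega> * Y j \<omega>) + (\<Sum>i\<in>I. c i * Y i \<omega>))"
  have intX: "integrable M (X i)" if "i \<in> I" for i
    using square_integrable_imp_integrable[of "X i"] sq[OF that] ind that
    by (auto simp: indep_vars_def)
  have "indep_vars (\<lambda>_. borel) Y I"
    unfolding Y_def by (rule indep_vars_compose2[OF ind, of "\<lambda>i y. y - m i"]) simp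
  moreover have "integrable M (\<lambda>\<omega>. (Y i \<omega>)\<^sup>2)" if "i \<in> I" for i
    unfolding Y_def power2_diff using sq intX that by (auto intro!: Bochner_Integration.integrable_add)
  moreover have "expectation (Y i) = 0" if "i \<in> I" for i
    unfolding Y_def using intX mean that by (simp add: prob_space)
  moreover have "expectation (\<lambda>\<omega>. (Y i \<omega>)\<^sup>2) = v i" if "i \<in> I" for i
    unfolding Y_def using var[OF that] mean[OF that] by simp
  ultimately have *: "integrable M F" "integrable M (\<lambda>\<omega>. (F \<omega>)\<^sup>2)" "expectation F = 0"
     "expectation (\<lambda>\<omega>. (F \<omega>)\<^sup>2)
           = 2 * (\<Sum>i\<in>I. \<Sum>j\<in>I. (a i j)\<^sup>2 * v i * v j) + (\<Sum>i\<in>I. (c i)\<^sup>2 * v i)"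
    unfolding F_def using expectation_quadratic_form_centered[where Y = Y and v = v and c = c and a = a, OF fin _ _ _ _ sym diag] by blast+
  have NF: "N = (\<lambda>\<omega>. F \<omega> + e)"
  proof
    fix \<omega>
    \<comment> \<open>The second cross term is written with \<open>a j i\<close>, so that exchanging
      the two sums turns it literally into the first.\<close>
    have "N \<omega> = (\<Sum>i\<in>I. \<Sum>j\<in>I. a i j * Y i \<omega> * Y j \<omega> + a i j * m j * Y i \<omega>
        + a j i * m i * Y j \<omega> + a i j * m i * m j)"
      unfolding N_def Y_def using sym by (intro sum.cong refl) (simp add: algebra_simps)
    also have "\<dots> = (\<Sum>i\<in>I. \<Sum>j\<in>I. a i j * Y i \<omega> * Y j \<omega>) + (\<Sum>i\<in>I. \<Sum>j\<in>I. a i j * m j * Y i \<omega>)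
        + (\<Sum>i\<in>I. \<Sum>j\<in>I. a j i * m i * Y j \<omega>) + e"
      by (simp add: sum.distrib e_def)
    also have "(\<Sum>i\<in>I. \<Sum>j\<in>I. a j i * m i * Y j \<omega>) = (\<Sum>i\<in>I. \<Sum>j\<in>I. a i j * m j * Y i \<omega>)"
      by (rule sum.swap)
    finally show "N \<omega> = F \<omega> + e"
      by (simp add: F_def c_def sum_distrib_left sum_distrib_right sum.distrib mult.assoc flip: mult_2)
  qed
  show "integrable M N" unfolding NF using * by simp
  have N2: "(\<lambda>\<omega>. (N \<omega>)\<^sup>2) = (\<lambda>\<omega>. (F \<omega>)\<^sup>2 + 2 * e * F \<omega> + e\<^sup>2)"
    unfolding NF by (simp add: power2_sum algebra_simps)
  show "integrable M (\<lambda>\<omega>. (N \<omega>)\<^sup>2)" unfolding N2 using * by simp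
  show E: "expectation N = (\<Sum>i\<in>I. \<Sum>j\<in>I. a i j * m i * m j)"
    unfolding NF using * by (simp add: prob_space e_def)
  have "variance N = expectation (\<lambda>\<omega>. (F \<omega>)\<^sup>2)"
    unfolding E e_def[symmetric] by (simp add: NF)
  also have "\<dots> = 2 * (\<Sum>i\<in>I. \<Sum>j\<in>I. (a i j)\<^sup>2 * v i * v j)
           + 4 * (\<Sum>i\<in>I. (\<Sum>j\<in>I. a i j * m j)\<^sup>2 * v i)"
    unfolding *(4) by (simp add: c_def power_mult_distrib mult.assoc sum_distrib_left[of 4])
  finally show "variance N = 2 * (\<Sum>i\<in>I. \<Sum>j\<in>I. (a i j)\<^sup>2 * v i * v j)
           + 4 * (\<Sum>i\<in>I. (\<Sum>j\<in>I. a i j * m j)\<^sup>2 * v i)" .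
qed

end

subsection \<open>Cell approximation of a pair kernel\<close>

text \<open>Total boundedness gives finitely many balls of radius \<open>\<epsilon>/2\<close>
  covering \<open>B\<close>; cut down to \<open>B\<close> and made disjoint they are the cells. Two
  points of a cell are compared through the centre of its ball. Cells beyond the last ball are
  empty.\<close>

lemma compact_fine_partition:
  fixes B :: "'a::metric_space set"
  assumes "compact B" "0 < \<epsilon>"
  obtains A :: "nat \<Rightarrow> 'a set" and m :: nat
  where "\<And>i. A i \<in> sets borel" "disjoint_family A" "(\<Union>i<m. A i) = B"
    "\<And>i x y. x \<in> A i \<Longrightarrow> y \<in> A i \<Longrightarrow> dist x y < \<epsilon>"
proof -
  obtain k where k: "finite k" "B \<subseteq> (\<Union>x\<in>k. ball x (\<epsilon>/2))"
    using assms compact_eq_totally_bounded[of B] half_gt_zero by blast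
  obtain xs where xs: "set xs = k" using finite_list[OF k(1)] by blast
  define U where "U = (\<lambda>i. if i < length xs then B \<inter> ball (xs ! i) (\<epsilon>/2) else {})"
  show ?thesis
  proof (rule that[of "disjointed U" "length xs"])
    have "U i \<in> sets borel" for i
      using borel_compact[OF assms(1)] by (auto simp: U_def)
    thus "disjointed U i \<in> sets borel" for i unfolding disjointed_def by auto
    show "disjoint_family (disjointed U)" by (rule disjoint_family_disjointed)
    have "(\<Union>i<length xs. disjointed U i) = (\<Union>i<length xs. U i)"
      using finite_UN_disjointed_eq[of U "length xs"] by (simp add: lessThan_atLeast0)
    also have "\<dots> = B \<inter> (\<Union>i<length xs. ball (xs ! i) (\<epsilon>/2))"
      unfolding U_def by auto
    also have "(\<Union>i<length xs. ball (xs ! i) (\<epsilon>/2)) = (\<Union>x\<in>k. ball x (\<epsilon>/2))"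
      unfolding xs[symmetric] set_conv_nth by auto
    finally show "(\<Union>i<length xs. disjointed U i) = B" using k(2) by auto
  next
    fix i x y assume "x \<in> disjointed U i" "y \<in> disjointed U i"
    hence "x \<in> U i" "y \<in> U i" by (auto simp: disjointed_def)
    hence "dist (xs ! i) x < \<epsilon>/2" "dist (xs ! i) y < \<epsilon>/2" by (auto simp: U_def split: if_splits)
    thus "dist x y < \<epsilon>" by (rule dist_triangle_half_r)
  qed
qed

text \<open>\<open>W\<close> is the relation whose pairs are to be counted. Partitions for different
  \<open>n\<close> are unrelated; the limits below rest on their mesh tending to zero.\<close>

locale cell_kernel =
  fixes W :: "('a::euclidean_space \<times> 'a) set" and B :: "'a set"
    and A :: "nat \<Rightarrow> nat \<Rightarrow> 'a set" and m :: "nat \<Rightarrow> nat"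
  assumes closed: "closed W" and sym: "\<And>x y. (x, y) \<in> W \<Longrightarrow> (y, x) \<in> W"
    and WB: "W \<subseteq> B \<times> B" and compact: "compact B"
    and borel: "\<And>n i. A n i \<in> sets borel"
    and disj: "\<And>n. disjoint_family (A n)"
    and cover: "\<And>n. (\<Union>i<m n. A n i) = B"
    and small: "\<And>n i x y. x \<in> A n i \<Longrightarrow> y \<in> A n i \<Longrightarrow> dist x y < 1 / real (Suc n)"
begin

text \<open>Excluding \<open>i = j\<close> gives the quadratic form in the cell counts the zero
  diagonal that its moment formulas require. The pairs lost lie within one cell, and any fixed pair
  of distinct points is eventually separated.\<close>

definition adj :: "nat \<Rightarrow> nat \<Rightarrow> nat \<Rightarrow> real" where
  "adj n i j = of_bool (i \<noteq> j \<and> (A n i \<times> A n j) \<inter> W \<noteq> {})"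

text \<open>This is \<open>adj\<close> as a step function of points. It links sums over cells both
  to sums over the points of a configuration and to integrals.\<close>

definition ker :: "nat \<Rightarrow> 'a \<Rightarrow> 'a \<Rightarrow> real" where
  "ker n x y = (\<Sum>i<m n. \<Sum>j<m n. adj n i j * indicator (A n i) x * indicator (A n j) y)"

lemma adj_sym: "adj n i j = adj n j i"
  unfolding adj_def using sym by (auto simp: of_bool_def)

lemma adj_diag: "adj n i i = 0"
  by (simp add: adj_def)

lemma adj_square: "(adj n i j)\<^sup>2 = adj n i j"
  by (simp add: adj_def)

lemma sum_indicator_cell:
  fixes c :: "nat \<Rightarrow> real"
  assumes "x \<in> A n i" "i < m n"
  shows "(\<Sum>k<m n. c k * indicator (A n k) x) = c i"
proof -
  have "indicator (A n k) x = (of_bool (k = i) :: real)" for k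
    using assms disj[of n] by (auto simp: disjoint_family_on_def indicator_def)
  thus ?thesis using assms by simp
qed

lemma sum_indicator_outside: "x \<notin> B \<Longrightarrow> (\<Sum>k<m n. c k * indicator (A n k) x) = (0::real)"
  using cover[of n] by (intro sum.neutral) (auto simp: indicator_def)

lemma cell_cases:
  obtains "x \<notin> B" | i where "x \<in> A n i" "i < m n"
  using cover[of n] by auto

lemma ker_cell: "x \<in> A n i \<Longrightarrow> y \<in> A n j \<Longrightarrow> i < m n \<Longrightarrow> j < m n \<Longrightarrow> ker n x y = adj n i j"
  unfolding ker_def by (simp only: sum_indicator_cell)

lemma ker_outside: "x \<notin> B \<or> y \<notin> B \<Longrightarrow> ker n x y = 0"
  unfolding ker_def using cover[of n]
  by (intro sum.neutral ballI) (auto simp: indicator_def)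

text \<open>The upper bound does not depend on \<open>n\<close> and is the majorant for dominated
  convergence.\<close>

lemma ker_bounds: "0 \<le> ker n x y" "ker n x y \<le> indicator B x * indicator B y"
proof -
  have "0 \<le> ker n x y \<and> ker n x y \<le> indicator B x * indicator B y"
  proof (cases "x \<in> B \<and> y \<in> B")
    case True
    then obtain i j where "i < m n" "x \<in> A n i" "j < m n" "y \<in> A n j"
      using cover[of n] by blast
    thus ?thesis using True by (simp add: ker_cell) (simp add: adj_def)
  qed (auto simp: ker_outside)
  thus "0 \<le> ker n x y" "ker n x y \<le> indicator B x * indicator B y" by auto
qed

text \<open>For a pair in \<open>W\<close>, the kernel is 1 once the mesh is below
  \<open>dist x y\<close>, since the points then lie in distinct cells. For a pair outside,
  closedness of \<open>W\<close> gives a ball of radius \<open>\<epsilon>\<close> missing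
  \<open>W\<close>; once the mesh is below \<open>\<epsilon> / 2\<close>, the product of the two
  cells lies in that ball.\<close>

lemma ker_tendsto:
  assumes "x \<noteq> y"
  shows "(\<lambda>n. ker n x y) \<longlonglongrightarrow> indicator W (x, y)"
proof (cases "x \<in> B \<and> y \<in> B")
  case False
  thus ?thesis using WB by (auto simp: ker_outside indicator_def)
next
  case True
  have ev: "eventually (\<lambda>n. 1 / real (Suc n) < \<epsilon>) sequentially" if "0 < \<epsilon>" for \<epsilon>
    using order_tendstoD(2)[OF LIMSEQ_inverse_real_of_nat that] by (simp add: divide_inverse)
  show ?thesis
  proof (cases "(x, y) \<in> W")
    case W: True
    have "eventually (\<lambda>n. 1 / real (Suc n) < dist x y) sequentially"
      using ev assms by simp
    hence "eventually (\<lambda>n. ker n x y = indicator W (x, y)) sequentially"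
    proof eventually_elim
      case (elim n)
      obtain i j where ij: "i < m n" "x \<in> A n i" "j < m n" "y \<in> A n j"
        using True cover[of n] by blast
      have "i \<noteq> j" using small[of x n i y] elim ij assms by auto
      thus ?case using ij W by (auto simp: ker_cell adj_def)
    qed
    thus ?thesis by (rule tendsto_eventually)
  next
    case W: False
    then obtain \<epsilon> where \<epsilon>: "0 < \<epsilon>" "ball (x, y) \<epsilon> \<subseteq> - W"
      using closed open_contains_ball[of "- W"] by (auto simp: open_Compl)
    have "eventually (\<lambda>n. 1 / real (Suc n) < \<epsilon> / 2) sequentially"
      using ev[of "\<epsilon> / 2"] \<epsilon>(1) half_gt_zero by blast
    hence "eventually (\<lambda>n. ker n x y = indicator W (x, y)) sequentially"
    proof eventually_elim
      case (elim n)
      obtain i j where ij: "i < m n" "x \<in> A n i" "j < m n" "y \<in> A n j"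
        using True cover[of n] by blast
      have "(u, v) \<notin> W" if "u \<in> A n i" "v \<in> A n j" for u v
      proof -
        have "dist (x, y) (u, v) \<le> dist x u + dist y v"
          by (simp add: dist_Pair_Pair sqrt_sum_squares_le_sum)
        also have "\<dots> < \<epsilon>" using small[of x n i u] small[of y n j v] ij that elim by linarith
        finally show ?thesis using \<epsilon> by auto
      qed
      thus ?case using ij W by (auto simp: ker_cell adj_def)
    qed
    thus ?thesis by (rule tendsto_eventually)
  qed
qed

lemma ker_diag: "ker n x x = 0"
  by (rule cell_cases[where x = x and n = n]) (simp_all add: ker_outside ker_cell adj_diag)

end

lemma cell_kernel_exists:
  fixes W :: "('a::euclidean_space \<times> 'a) set"
  assumes "closed W" "\<And>x y. (x, y) \<in> W \<Longrightarrow> (y, x) \<in> W" "W \<subseteq> B \<times> B" "compact B"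
  obtains A m where "cell_kernel W B A m"
proof -
  let ?P = "\<lambda>n (p :: (nat \<Rightarrow> 'a set) \<times> nat). (\<forall>i. fst p i \<in> sets borel) \<and> disjoint_family (fst p) \<and> (\<Union>i<snd p. fst p i) = B \<and>
      (\<forall>i x y. x \<in> fst p i \<longrightarrow> y \<in> fst p i \<longrightarrow> dist x y < 1 / real (Suc n))"
  have "\<exists>p. ?P n p" for n
  proof (rule compact_fine_partition[OF assms(4), of "1 / real (Suc n)"])
    fix A :: "nat \<Rightarrow> 'a set" and m :: nat
    assume A: "\<And>i. A i \<in> sets borel" "disjoint_family A" "(\<Union>i<m. A i) = B"
      "\<And>i x y. x \<in> A i \<Longrightarrow> y \<in> A i \<Longrightarrow> dist x y < 1 / real (Suc n)"
    show "\<exists>p. ?P n p" by (rule exI[of _ "(A, m)"]) (use A in simp)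
  qed simp
  then obtain p where p: "\<And>n. ?P n (p n)" using choice[of ?P] by blast
  have "cell_kernel W B (\<lambda>n. fst (p n)) (\<lambda>n. snd (p n))"
    by unfold_locales (use assms p in blast)+
  thus ?thesis by (rule that)
qed

section \<open>Integrals of the cell kernel and their limits\<close>

context cell_kernel
begin

text \<open>\<open>\<mu>\<close> stands for the intensity measure. Having no atoms, it gives mass
  zero to the point \<open>y = x\<close>, where the kernel need not converge to the indicator of
  \<open>W\<close>.\<close>

context
  fixes \<mu> :: "'a measure"
  assumes sets_\<mu>: "sets \<mu> = sets borel" and finB: "emeasure \<mu> B < \<infinity>"
    and atomless: "\<And>x. emeasure \<mu> {x} = 0"
begin

text \<open>For a Poisson process of intensity measure \<open>\<mu>\<close> this is the mean number
  of points in the cells adjacent to cell \<open>i\<close>.\<close>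

definition cell_degree :: "nat \<Rightarrow> nat \<Rightarrow> real" where
  "cell_degree n i = (\<Sum>j<m n. adj n i j * measure \<mu> (A n j))"

lemma borel_B: "B \<in> sets borel"
  using compact by (rule borel_compact)

lemma finite_cell: "i < m n \<Longrightarrow> emeasure \<mu> (A n i) < \<infinity>"
proof -
  assume "i < m n"
  hence "emeasure \<mu> (A n i) \<le> emeasure \<mu> B"
    using cover[of n] borel_B sets_\<mu> by (intro emeasure_mono) auto
  thus ?thesis using finB by (rule order_le_less_trans)
qed

lemma integrable_B: "integrable \<mu> (\<lambda>x. c * indicator B x :: real)"
  using finB borel_B sets_\<mu> by simp

lemma integrable_cell: "i < m n \<Longrightarrow> integrable \<mu> (\<lambda>x. c * indicator (A n i) x :: real)"
  using finite_cell borel sets_\<mu> by simp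

lemma integral_sum_indicator_cell:
  fixes c :: "nat \<Rightarrow> real"
  shows "(\<integral>x. (\<Sum>i<m n. c i * indicator (A n i) x) \<partial>\<mu>) = (\<Sum>i<m n. c i * measure \<mu> (A n i))"
proof (subst Bochner_Integration.integral_sum)
  show "(\<Sum>i<m n. \<integral>x. c i * indicator (A n i) x \<partial>\<mu>) = (\<Sum>i<m n. c i * measure \<mu> (A n i))"
    using sets_eq_imp_space_eq[OF sets_\<mu>] by (intro sum.cong) simp_all
qed (simp only: integrable_cell lessThan_iff)

lemma ker_eq_sum:
  "ker n x y = (\<Sum>j<m n. (\<Sum>i<m n. adj n i j * indicator (A n i) x) * indicator (A n j) y)"
  unfolding ker_def sum_distrib_right by (rule sum.swap)

lemma integral_ker: "(\<integral>y. ker n x y \<partial>\<mu>) = (\<Sum>i<m n. cell_degree n i * indicator (A n i) x)"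
proof -
  have "(\<integral>y. ker n x y \<partial>\<mu>)
      = (\<Sum>j<m n. \<Sum>i<m n. adj n i j * indicator (A n i) x * measure \<mu> (A n j))"
    by (simp only: ker_eq_sum integral_sum_indicator_cell) (simp only: sum_distrib_right)
  also have "\<dots> = (\<Sum>i<m n. \<Sum>j<m n. adj n i j * measure \<mu> (A n j) * indicator (A n i) x)"
    by (subst sum.swap) (simp only: mult_ac)
  finally show ?thesis unfolding cell_degree_def sum_distrib_right .
qed

text \<open>At most one cell contains \<open>x\<close>, so squaring the step function squares its
  coefficients.\<close>

lemma integral_ker_square:
  "(\<integral>y. ker n x y \<partial>\<mu>)\<^sup>2 = (\<Sum>i<m n. (cell_degree n i)\<^sup>2 * indicator (A n i) x)"
  unfolding integral_ker
  by (rule cell_cases[where x = x and n = n])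
    (simp_all only: sum_indicator_cell sum_indicator_outside not_False_eq_True zero_power2)

lemma integral_integral_ker:
  "(\<integral>x. (\<integral>y. ker n x y \<partial>\<mu>) \<partial>\<mu>) = (\<Sum>i<m n. cell_degree n i * measure \<mu> (A n i))"
  unfolding integral_ker by (rule integral_sum_indicator_cell)

lemma integral_integral_ker_square:
  "(\<integral>x. (\<integral>y. ker n x y \<partial>\<mu>)\<^sup>2 \<partial>\<mu>) = (\<Sum>i<m n. (cell_degree n i)\<^sup>2 * measure \<mu> (A n i))"
  unfolding integral_ker_square by (rule integral_sum_indicator_cell)

lemma measurable_ker [measurable]: "(\<lambda>y. ker n x y) \<in> borel_measurable \<mu>"
  unfolding ker_def using borel sets_\<mu> by measurable

lemma measurable_integral_ker [measurable]: "(\<lambda>x. \<integral>y. ker n x y \<partial>\<mu>) \<in> borel_measurable \<mu>"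
  unfolding integral_ker using borel sets_\<mu> by measurable

lemma integral_ker_bounds:
  "0 \<le> (\<integral>y. ker n x y \<partial>\<mu>)" "(\<integral>y. ker n x y \<partial>\<mu>) \<le> measure \<mu> B * indicator B x"
proof -
  show "0 \<le> (\<integral>y. ker n x y \<partial>\<mu>)" by (simp add: ker_bounds)
  have "(\<integral>y. ker n x y \<partial>\<mu>) \<le> (\<integral>y. indicator B x * indicator B y \<partial>\<mu>)"
  proof (rule integral_mono_AE')
    show "integrable \<mu> (\<lambda>y. indicator B x * indicator B y :: real)" by (rule integrable_B)
  qed (simp_all add: ker_bounds)
  also have "\<dots> = measure \<mu> B * indicator B x"
    using borel_B sets_\<mu> finB by (simp add: sets_eq_imp_space_eq)
  finally show "(\<integral>y. ker n x y \<partial>\<mu>) \<le> measure \<mu> B * indicator B x" .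
qed

lemma section_borel: "{y. (x, y) \<in> W} \<in> sets borel"
proof -
  have "{y. (x, y) \<in> W} = Pair x -` W" by auto
  moreover have "closed (Pair x -` W)"
    by (intro continuous_closed_vimage closed) (auto intro!: continuous_intros)
  ultimately show ?thesis by simp
qed

text \<open>Dominated convergence with majorant the indicator of \<open>B\<close>; the exceptional
  point \<open>y = x\<close> is a null set.\<close>

lemma integral_ker_tendsto: "(\<lambda>n. \<integral>y. ker n x y \<partial>\<mu>) \<longlonglongrightarrow> measure \<mu> {y. (x, y) \<in> W}"
proof -
  have "(\<lambda>n. \<integral>y. ker n x y \<partial>\<mu>) \<longlonglongrightarrow> (\<integral>y. indicator {y. (x, y) \<in> W} y \<partial>\<mu>)"
  proof (rule integral_dominated_convergence)
    show "integrable \<mu> (\<lambda>y. 1 * indicator B y :: real)" by (rule integrable_B)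
    show "(\<lambda>y. indicator {y. (x, y) \<in> W} y :: real) \<in> borel_measurable \<mu>"
      using section_borel sets_\<mu> by simp
    have "AE y in \<mu>. y \<noteq> x"
      using atomless sets_\<mu> by (intro AE_I[of _ _ "{x}"]) auto
    thus "AE y in \<mu>. (\<lambda>n. ker n x y) \<longlonglongrightarrow> indicator {y. (x, y) \<in> W} y"
    proof eventually_elim
      case (elim y)
      thus ?case using ker_tendsto[of x y] by (simp add: indicator_def)
    qed
    have "norm (ker n x y) \<le> 1 * indicator B y" for n y
      using ker_bounds[of n x y] by (cases "x \<in> B") auto
    thus "AE y in \<mu>. norm (ker n x y) \<le> 1 * indicator B y" for n by simp
  qed simp
  also have "(\<integral>y. indicator {y. (x, y) \<in> W} y \<partial>\<mu>) = measure \<mu> {y. (x, y) \<in> W}"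
    using section_borel[of x] sets_\<mu> by (simp add: sets_eq_imp_space_eq)
  finally show ?thesis .
qed

lemma measurable_section: "(\<lambda>x. measure \<mu> {y. (x, y) \<in> W}) \<in> borel_measurable \<mu>"
  using integral_ker_tendsto measurable_integral_ker by (rule borel_measurable_LIMSEQ_real)

lemma integral_integral_ker_tendsto:
  "(\<lambda>n. \<integral>x. (\<integral>y. ker n x y \<partial>\<mu>) \<partial>\<mu>) \<longlonglongrightarrow> (\<integral>x. measure \<mu> {y. (x, y) \<in> W} \<partial>\<mu>)"
  by (rule integral_dominated_convergence[OF measurable_section _ integrable_B[of "measure \<mu> B"]])
    (use integral_ker_tendsto integral_ker_bounds in auto)

lemma integral_integral_ker_square_tendsto:
  "(\<lambda>n. \<integral>x. (\<integral>y. ker n x y \<partial>\<mu>)\<^sup>2 \<partial>\<mu>) \<longlonglongrightarrow> (\<integral>x. (measure \<mu> {y. (x, y) \<in> W})\<^sup>2 \<partial>\<mu>)"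
proof (rule integral_dominated_convergence)
  show "(\<lambda>x. (measure \<mu> {y. (x, y) \<in> W})\<^sup>2) \<in> borel_measurable \<mu>"
    using measurable_section by simp
  show "integrable \<mu> (\<lambda>x. (measure \<mu> B)\<^sup>2 * indicator B x)" by (rule integrable_B)
  show "AE x in \<mu>. (\<lambda>n. (\<integral>y. ker n x y \<partial>\<mu>)\<^sup>2) \<longlonglongrightarrow> (measure \<mu> {y. (x, y) \<in> W})\<^sup>2"
    by (intro AE_I2 tendsto_power integral_ker_tendsto)
  have "(\<integral>y. ker n x y \<partial>\<mu>)\<^sup>2 \<le> (measure \<mu> B * indicator B x)\<^sup>2" for n x
    by (intro power_mono integral_ker_bounds)
  thus "AE x in \<mu>. norm ((\<integral>y. ker n x y \<partial>\<mu>)\<^sup>2) \<le> (measure \<mu> B)\<^sup>2 * indicator B x" for n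
    by (simp add: power_mult_distrib power2_eq_square[of "indicator B _"] flip: indicator_inter_arith)
qed simp

end

end

subsection \<open>Mean and variance of pair counts\<close>

text \<open>Infinite sets are covered too: their \<open>card\<close> is 0 by convention, and so is
  \<open>enn2real\<close> of infinity. Hence independence transfers from \<open>point_count\<close>
  by composition alone.\<close>

lemma card_eq_point_count: "real (card (\<eta> \<omega> \<inter> B)) = enn2real (point_count \<eta> B \<omega>)"
  by (cases "finite (\<eta> \<omega> \<inter> B)") (auto simp: point_count_def)

text \<open>On a bounded set the count is finite, so \<open>card\<close> and
  \<open>point_count\<close> define the same events. As \<open>nat\<close> is countable,
  measurability is checked on singletons.\<close>

lemma poisson_process_card:
  fixes \<eta> :: "'w \<Rightarrow> 'a::euclidean_space set"
  assumes P: "poisson_process M \<mu> \<eta>" and B: "B \<in> sets borel" "bounded B" "emeasure \<mu> B < \<infinity>"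
  shows "(\<lambda>\<omega>. card (\<eta> \<omega> \<inter> B)) \<in> M \<rightarrow>\<^sub>M count_space UNIV"
    and "integrable M (\<lambda>\<omega>. real (card (\<eta> \<omega> \<inter> B)) ^ r)"
    and "prob_space.expectation M (\<lambda>\<omega>. real (card (\<eta> \<omega> \<inter> B))) = measure \<mu> B"
    and "prob_space.variance M (\<lambda>\<omega>. real (card (\<eta> \<omega> \<inter> B))) = measure \<mu> B"
proof -
  have fin: "finite (\<eta> \<omega> \<inter> B)" if "\<omega> \<in> space M" for \<omega>
    using P B(2) that unfolding poisson_process_def by blast
  have M: "prob_space M" and meas[measurable]: "point_count \<eta> B \<in> borel_measurable M"
    using P B(1) unfolding poisson_process_def by blast+
  have set_eq: "{\<omega>\<in>space M. card (\<eta> \<omega> \<inter> B) = k} = {\<omega>\<in>space M. point_count \<eta> B \<omega> = of_nat k}" for k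
    using fin by (auto simp: point_count_def emeasure_count_space_finite)
  have "(\<lambda>\<omega>. card (\<eta> \<omega> \<inter> B)) -` {k} \<inter> space M \<in> sets M" for k
  proof -
    have "(\<lambda>\<omega>. card (\<eta> \<omega> \<inter> B)) -` {k} \<inter> space M = {\<omega>\<in>space M. point_count \<eta> B \<omega> = of_nat k}"
      using set_eq[of k] by auto
    thus ?thesis by simp
  qed
  thus N: "(\<lambda>\<omega>. card (\<eta> \<omega> \<inter> B)) \<in> M \<rightarrow>\<^sub>M count_space UNIV"
    by (auto simp: measurable_count_space_eq2_countable)
  have "measure M {\<omega>\<in>space M. card (\<eta> \<omega> \<inter> B) = k}
      = exp (- measure \<mu> B) * measure \<mu> B ^ k / fact k" for k
    unfolding set_eq using P B(1,3) unfolding poisson_process_def by blast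
  from poisson_moments[OF M N this]
  show "integrable M (\<lambda>\<omega>. real (card (\<eta> \<omega> \<inter> B)) ^ r)"
    "prob_space.expectation M (\<lambda>\<omega>. real (card (\<eta> \<omega> \<inter> B))) = measure \<mu> B"
    "prob_space.variance M (\<lambda>\<omega>. real (card (\<eta> \<omega> \<inter> B))) = measure \<mu> B" .
qed

lemma poisson_process_indep_cards:
  fixes \<eta> :: "'w \<Rightarrow> 'a::euclidean_space set"
  assumes P: "poisson_process M \<mu> \<eta>" and "\<And>i. A i \<in> sets borel" "disjoint_family A"
  shows "prob_space.indep_vars M (\<lambda>_. borel) (\<lambda>i \<omega>. real (card (\<eta> \<omega> \<inter> A i))) {..<m::nat}"
proof -
  have M: "prob_space M" using P unfolding poisson_process_def by blast
  interpret prob_space M by (fact M)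
  have d: "disjoint_family_on A {..<m}" using assms(3) by (rule disjoint_family_on_mono[rotated]) simp
  have "\<forall>(A :: nat \<Rightarrow> 'a set) m. (\<forall>i<m. A i \<in> sets borel) \<longrightarrow> disjoint_family_on A {..<m} \<longrightarrow>
        indep_vars (\<lambda>_. borel) (\<lambda>i. point_count \<eta> (A i)) {..<m}"
    using P unfolding poisson_process_def by blast
  hence "indep_vars (\<lambda>_. borel) (\<lambda>i. point_count \<eta> (A i)) {..<m}"
    using assms(2) d by blast
  thus ?thesis unfolding card_eq_point_count by (rule indep_vars_compose2) measurable
qed

text \<open>The pair count becomes a sum over the finite index set \<open>X \<inter> B\<close>,
  which does not depend on the partition, so kernels can be passed to the limit term by
  term.\<close>

lemma card_pairs_eq_sum:
  assumes "finite (X \<inter> B)" "W \<subseteq> B \<times> B"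
  shows "real (card {(x, y) \<in> W. x \<in> X \<and> y \<in> X \<and> x \<noteq> y})
    = (\<Sum>x\<in>X \<inter> B. \<Sum>y\<in>X \<inter> B. of_bool ((x, y) \<in> W \<and> x \<noteq> y))"
proof -
  let ?F = "X \<inter> B"
  have "(\<Sum>x\<in>?F. \<Sum>y\<in>?F. of_bool ((x, y) \<in> W \<and> x \<noteq> y))
      = (\<Sum>p\<in>?F \<times> ?F. of_bool (p \<in> W \<and> fst p \<noteq> snd p) :: real)"
    unfolding sum.cartesian_product by (intro sum.cong) auto
  also have "\<dots> = real (card ((?F \<times> ?F) \<inter> {p. p \<in> W \<and> fst p \<noteq> snd p}))"
    using assms(1) by (subst sum_of_bool_eq) auto
  also have "(?F \<times> ?F) \<inter> {p. p \<in> W \<and> fst p \<noteq> snd p} = {(x, y) \<in> W. x \<in> X \<and> y \<in> X \<and> x \<noteq> y}"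
    using assms(2) by auto
  finally show ?thesis ..
qed

text \<open>Each cell count is a sum of indicators over the points; exchanging the sums over cells
  with those over points leaves the kernel.\<close>

lemma (in cell_kernel) sum_cells_eq_sum_points:
  assumes "finite (X \<inter> B)"
  shows "(\<Sum>i<m n. \<Sum>j<m n. adj n i j * real (card (X \<inter> A n i)) * real (card (X \<inter> A n j)))
    = (\<Sum>x\<in>X \<inter> B. \<Sum>y\<in>X \<inter> B. ker n x y)"
proof -
  let ?F = "X \<inter> B"
  have card: "real (card (X \<inter> A n i)) = (\<Sum>x\<in>?F. indicator (A n i) x)" if "i < m n" for i
  proof -
    have "?F \<inter> A n i = X \<inter> A n i" using cover[of n] that by blast
    thus ?thesis using assms by (simp add: indicator_def)
  qed
  have "(\<Sum>i<m n. \<Sum>j<m n. adj n i j * real (card (X \<inter> A n i)) * real (card (X \<inter> A n j)))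
      = (\<Sum>i<m n. \<Sum>j<m n. \<Sum>x\<in>?F. \<Sum>y\<in>?F. adj n i j * indicator (A n i) x * indicator (A n j) y)"
  proof (intro sum.cong refl)
    fix i j assume "i \<in> {..<m n}" "j \<in> {..<m n}"
    hence "adj n i j * real (card (X \<inter> A n i)) * real (card (X \<inter> A n j))
      = adj n i j * (\<Sum>x\<in>?F. indicator (A n i) x) * (\<Sum>y\<in>?F. indicator (A n j) y)"
      by (simp only: card lessThan_iff)
    thus "adj n i j * real (card (X \<inter> A n i)) * real (card (X \<inter> A n j))
      = (\<Sum>x\<in>?F. \<Sum>y\<in>?F. adj n i j * indicator (A n i) x * indicator (A n j) y)"
      unfolding mult.assoc unfolding sum_product unfolding sum_distrib_left .
  qed
  \<comment> \<open>Pairs of cells and pairs of points are bundled so that a single exchange of sums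
    suffices.\<close>
  also have "\<dots> = (\<Sum>q\<in>{..<m n} \<times> {..<m n}. \<Sum>p\<in>?F \<times> ?F.
      adj n (fst q) (snd q) * indicator (A n (fst q)) (fst p) * indicator (A n (snd q)) (snd p))"
    by (simp only: sum.cartesian_product' fst_conv snd_conv)
  also have "\<dots> = (\<Sum>p\<in>?F \<times> ?F. \<Sum>q\<in>{..<m n} \<times> {..<m n}.
      adj n (fst q) (snd q) * indicator (A n (fst q)) (fst p) * indicator (A n (snd q)) (snd p))"
    by (rule sum.swap)
  also have "\<dots> = (\<Sum>x\<in>?F. \<Sum>y\<in>?F. ker n x y)"
    unfolding ker_def by (simp only: sum.cartesian_product' fst_conv snd_conv)
  finally show ?thesis .
qed

text \<open>\<open>N\<close> counts ordered pairs, so every edge appears twice. The forms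
  \<open>S n\<close> in the cell counts have explicit mean and variance, converge pointwise to
  \<open>N\<close> and are dominated by the square of the number of points in \<open>B\<close>;
  hence first and second moments converge, and so do the explicit formulas.\<close>

proposition poisson_pair_count_moments:
  fixes \<eta> :: "'w \<Rightarrow> 'a::euclidean_space set" and W :: "('a \<times> 'a) set" and \<mu> :: "'a measure"
  assumes P: "poisson_process M \<mu> \<eta>" and sets: "sets \<mu> = sets borel"
    and W: "closed W" "\<And>x y. (x, y) \<in> W \<Longrightarrow> (y, x) \<in> W" "W \<subseteq> B \<times> B"
    and B: "compact B" "emeasure \<mu> B < \<infinity>" and atomless: "\<And>x. emeasure \<mu> {x} = 0"
  defines "N \<equiv> \<lambda>\<omega>. real (card {(x, y) \<in> W. x \<in> \<eta> \<omega> \<and> y \<in> \<eta> \<omega> \<and> x \<noteq> y})"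
    and "g \<equiv> \<lambda>x. measure \<mu> {y. (x, y) \<in> W}"
  shows "prob_space.expectation M N = (\<integral>x. g x \<partial>\<mu>)"
    and "prob_space.variance M N = 2 * (\<integral>x. g x \<partial>\<mu>) + 4 * (\<integral>x. (g x)\<^sup>2 \<partial>\<mu>)"
proof -
  have M: "prob_space M" using P unfolding poisson_process_def by blast
  interpret prob_space M by (fact M)
  obtain A m where "cell_kernel W B A m"
    using cell_kernel_exists[OF W B(1)] by blast
  then interpret cell_kernel W B A m .
  note ctx = sets B(2) atomless
  have fin: "finite (\<eta> \<omega> \<inter> B)" if "\<omega> \<in> space M" for \<omega>
    using P that compact_imp_bounded[OF B(1)] unfolding poisson_process_def by blast
  define X where "X = (\<lambda>n i \<omega>. real (card (\<eta> \<omega> \<inter> A n i)))"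
  define S where "S = (\<lambda>n \<omega>. \<Sum>i<m n. \<Sum>j<m n. adj n i j * X n i \<omega> * X n j \<omega>)"
  define K where "K = (\<lambda>\<omega>. real (card (\<eta> \<omega> \<inter> B)))"
  have bnd: "bounded (A n i)" if "i < m n" for n i
    using cover[of n] that compact_imp_bounded[OF B(1)] by (blast intro: bounded_subset)
  have cell: "integrable M (\<lambda>\<omega>. X n i \<omega> ^ r)" "expectation (X n i) = measure \<mu> (A n i)"
    "variance (X n i) = measure \<mu> (A n i)" if "i < m n" for n i r
    unfolding X_def
    using poisson_process_card(2-4)[OF P borel bnd[OF that] finite_cell[OF ctx that]] by blast+
  have indep: "indep_vars (\<lambda>_. borel) (X n) {..<m n}" for n
    unfolding X_def by (rule poisson_process_indep_cards[OF P borel disj])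
  have intK: "integrable M (\<lambda>\<omega>. K \<omega> ^ r)" for r
    unfolding K_def
    by (rule poisson_process_card(2)[OF P borel_compact[OF B(1)] compact_imp_bounded[OF B(1)] B(2)])
  have S: "integrable M (S n)" "integrable M (\<lambda>\<omega>. (S n \<omega>)\<^sup>2)"
    and ES: "expectation (S n) = (\<integral>x. (\<integral>y. ker n x y \<partial>\<mu>) \<partial>\<mu>)"
    and VS: "variance (S n) = 2 * (\<integral>x. (\<integral>y. ker n x y \<partial>\<mu>) \<partial>\<mu>) + 4 * (\<integral>x. (\<integral>y. ker n x y \<partial>\<mu>)\<^sup>2 \<partial>\<mu>)"
    for n
  proof -
    \<comment> \<open>A Poisson count has equal mean and variance, so both parameters are the
      measure of the cell.\<close>
    note q = moments_quadratic_form[where a = "adj n" and m = "\<lambda>i. measure \<mu> (A n i)"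
        and v = "\<lambda>i. measure \<mu> (A n i)", OF finite_lessThan indep _ _ _ adj_sym adj_diag]
    have Sn: "S n = (\<lambda>\<omega>. \<Sum>i<m n. \<Sum>j<m n. adj n i j * X n i \<omega> * X n j \<omega>)"
      by (simp only: S_def)
    show "integrable M (S n)"
      unfolding Sn by (rule q; rule cell; simp only: lessThan_iff)
    show "integrable M (\<lambda>\<omega>. (S n \<omega>)\<^sup>2)"
      unfolding Sn by (rule q; rule cell; simp only: lessThan_iff)
    have deg: "(\<Sum>i<m n. \<Sum>j<m n. adj n i j * measure \<mu> (A n i) * measure \<mu> (A n j))
        = (\<integral>x. (\<integral>y. ker n x y \<partial>\<mu>) \<partial>\<mu>)"
      unfolding integral_integral_ker[OF ctx] cell_degree_def[OF ctx]
      by (simp add: sum_distrib_left sum_distrib_right mult_ac)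
    have "expectation (S n) = (\<Sum>i<m n. \<Sum>j<m n. adj n i j * measure \<mu> (A n i) * measure \<mu> (A n j))"
      unfolding Sn by (rule q; rule cell; simp only: lessThan_iff)
    thus "expectation (S n) = (\<integral>x. (\<integral>y. ker n x y \<partial>\<mu>) \<partial>\<mu>)" unfolding deg .
    have "variance (S n)
        = 2 * (\<Sum>i<m n. \<Sum>j<m n. (adj n i j)\<^sup>2 * measure \<mu> (A n i) * measure \<mu> (A n j))
          + 4 * (\<Sum>i<m n. (\<Sum>j<m n. adj n i j * measure \<mu> (A n j))\<^sup>2 * measure \<mu> (A n i))"
      unfolding Sn by (rule q; rule cell; simp only: lessThan_iff)
    thus "variance (S n)
        = 2 * (\<integral>x. (\<integral>y. ker n x y \<partial>\<mu>) \<partial>\<mu>) + 4 * (\<integral>x. (\<integral>y. ker n x y \<partial>\<mu>)\<^sup>2 \<partial>\<mu>)"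
      unfolding adj_square deg integral_integral_ker_square[OF ctx] cell_degree_def[OF ctx] .
  qed
  have S_eq: "S n \<omega> = (\<Sum>x\<in>\<eta> \<omega> \<inter> B. \<Sum>y\<in>\<eta> \<omega> \<inter> B. ker n x y)" if "\<omega> \<in> space M" for n \<omega>
    unfolding S_def X_def by (rule sum_cells_eq_sum_points[OF fin[OF that]])
  \<comment> \<open>Diagonal terms agree for every \<open>n\<close>: the kernel vanishes at
    \<open>x = y\<close>, and \<open>N\<close> omits these pairs.\<close>
  have lim: "(\<lambda>n. S n \<omega>) \<longlonglongrightarrow> N \<omega>" if "\<omega> \<in> space M" for \<omega>
    unfolding S_eq[OF that] N_def card_pairs_eq_sum[OF fin[OF that] W(3)]
  proof (intro tendsto_sum)
    fix x y
    show "(\<lambda>n. ker n x y) \<longlonglongrightarrow> of_bool ((x, y) \<in> W \<and> x \<noteq> y)"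
      using ker_tendsto[of x y] by (cases "x = y") (simp_all add: ker_diag indicator_def)
  qed
  have bound: "norm (S n \<omega>) \<le> K \<omega> ^ 2" if "\<omega> \<in> space M" for n \<omega>
  proof -
    have "0 \<le> S n \<omega>" unfolding S_eq[OF that] by (intro sum_nonneg ker_bounds)
    moreover have "S n \<omega> \<le> (\<Sum>x\<in>\<eta> \<omega> \<inter> B. \<Sum>y\<in>\<eta> \<omega> \<inter> B. 1)"
      unfolding S_eq[OF that]
    proof (intro sum_mono)
      fix x y show "ker n x y \<le> 1"
        by (rule order_trans[OF ker_bounds(2)]) (simp add: indicator_def)
    qed
    ultimately show ?thesis by (simp add: K_def power2_eq_square)
  qed
  \<comment> \<open>Convergence of the second moments thus rests on the fourth moment of the Poisson
    variable \<open>K\<close>.\<close>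
  have bound2: "norm ((S n \<omega>)\<^sup>2) \<le> K \<omega> ^ 4" if "\<omega> \<in> space M" for n \<omega>
  proof -
    have "norm (S n \<omega>) ^ 2 \<le> (K \<omega> ^ 2) ^ 2" by (intro power_mono bound that) simp
    thus ?thesis by (simp flip: power_mult)
  qed
  have measS: "S n \<in> borel_measurable M" for n using S(1) by blast
  have measN: "N \<in> borel_measurable M"
    using lim measS by (rule borel_measurable_LIMSEQ_real)
  have intN: "integrable M N"
    by (rule integrable_dominated_convergence[OF measN measS intK[of 2]])
      (use lim bound in \<open>auto intro!: AE_I2\<close>)
  have limE: "(\<lambda>n. expectation (S n)) \<longlonglongrightarrow> expectation N"
    by (rule integral_dominated_convergence[OF measN measS intK[of 2]])
      (use lim bound in \<open>auto intro!: AE_I2\<close>)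
  have meas2: "(\<lambda>\<omega>. (N \<omega>)\<^sup>2) \<in> borel_measurable M" "(\<lambda>\<omega>. (S n \<omega>)\<^sup>2) \<in> borel_measurable M" for n
    using measN measS by measurable
  have lim2: "(\<lambda>n. (S n \<omega>)\<^sup>2) \<longlonglongrightarrow> (N \<omega>)\<^sup>2" if "\<omega> \<in> space M" for \<omega>
    by (intro tendsto_power lim that)
  have intN2: "integrable M (\<lambda>\<omega>. (N \<omega>)\<^sup>2)"
    by (rule integrable_dominated_convergence[OF meas2 intK[of 4]])
      (use lim2 bound2 in \<open>auto intro!: AE_I2\<close>)
  have limE2: "(\<lambda>n. expectation (\<lambda>\<omega>. (S n \<omega>)\<^sup>2)) \<longlonglongrightarrow> expectation (\<lambda>\<omega>. (N \<omega>)\<^sup>2)"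
    by (rule integral_dominated_convergence[OF meas2 intK[of 4]])
      (use lim2 bound2 in \<open>auto intro!: AE_I2\<close>)
  have limg: "(\<lambda>n. \<integral>x. (\<integral>y. ker n x y \<partial>\<mu>) \<partial>\<mu>) \<longlonglongrightarrow> (\<integral>x. g x \<partial>\<mu>)"
    unfolding g_def by (rule integral_integral_ker_tendsto[OF ctx])
  have limg2: "(\<lambda>n. \<integral>x. (\<integral>y. ker n x y \<partial>\<mu>)\<^sup>2 \<partial>\<mu>) \<longlonglongrightarrow> (\<integral>x. (g x)\<^sup>2 \<partial>\<mu>)"
    unfolding g_def by (rule integral_integral_ker_square_tendsto[OF ctx])
  show "expectation N = (\<integral>x. g x \<partial>\<mu>)"
    using limE limg unfolding ES by (rule LIMSEQ_unique)
  have "(\<lambda>n. variance (S n)) \<longlonglongrightarrow> variance N"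
    unfolding variance_eq[OF S] variance_eq[OF intN intN2]
    by (intro tendsto_diff tendsto_power limE limE2)
  moreover have "(\<lambda>n. variance (S n)) \<longlonglongrightarrow> 2 * (\<integral>x. g x \<partial>\<mu>) + 4 * (\<integral>x. (g x)\<^sup>2 \<partial>\<mu>)"
    unfolding VS by (intro tendsto_add tendsto_mult tendsto_const limg limg2)
  ultimately show "variance N = 2 * (\<integral>x. g x \<partial>\<mu>) + 4 * (\<integral>x. (g x)\<^sup>2 \<partial>\<mu>)"
    by (rule LIMSEQ_unique)
qed

subsection \<open>Edges as pairs of points\<close>

definition edge_pairs :: "real \<Rightarrow> ('a::euclidean_space \<times> 'a) set" where
  "edge_pairs \<delta> = {(x, y). norm (x - y) \<le> \<delta> \<and> (x + y) /\<^sub>R 2 \<in> cball 0 1}"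

lemma closed_edge_pairs: "closed (edge_pairs \<delta> :: ('a::euclidean_space \<times> 'a) set)"
proof -
  have "(edge_pairs \<delta> :: ('a \<times> 'a) set) = {p. norm (fst p - snd p) \<le> \<delta>} \<inter> {p. norm ((fst p + snd p) /\<^sub>R 2) \<le> 1}"
    unfolding edge_pairs_def by auto
  moreover have "closed {p::'a\<times>'a. norm (fst p - snd p) \<le> \<delta>}"
    "closed {p::'a\<times>'a. norm ((fst p + snd p) /\<^sub>R 2) \<le> 1}"
    by (intro closed_Collect_le continuous_intros)+
  ultimately show ?thesis by (simp only: closed_Int)
qed

lemma edge_pairs_sym: "(x, y) \<in> edge_pairs \<delta> \<Longrightarrow> (y, x) \<in> edge_pairs \<delta>"
  by (simp add: edge_pairs_def norm_minus_commute add.commute)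

text \<open>An endpoint is the midpoint plus half the difference of the endpoints.\<close>

lemma edge_pairs_norm:
  assumes "(x, y) \<in> edge_pairs \<delta>"
  shows "norm x \<le> 1 + \<delta> / 2"
proof -
  have "x = (x + y) /\<^sub>R 2 + (x - y) /\<^sub>R 2" by (simp add: algebra_simps flip: scaleR_add_left)
  hence "norm x \<le> norm ((x + y) /\<^sub>R 2) + norm ((x - y) /\<^sub>R 2)" using norm_triangle_ineq by metis
  thus ?thesis using assms by (simp add: edge_pairs_def)
qed

lemma edge_pairs_subset: "edge_pairs \<delta> \<subseteq> cball 0 (1 + \<delta> / 2) \<times> cball 0 (1 + \<delta> / 2)"
  using edge_pairs_norm edge_pairs_sym by fastforce

text \<open>Both endpoints of an edge lie in a ball containing finitely many points of
  \<open>X\<close>, so the infinite sum reduces to a finite one.\<close>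

lemma edge_count_eq_card:
  assumes "finite (X \<inter> cball 0 (1 + \<delta> / 2))"
  shows "edge_count \<delta> X = 1/2 * real (card {(x, y) \<in> edge_pairs \<delta>. x \<in> X \<and> y \<in> X \<and> x \<noteq> y})"
proof -
  let ?T = "{(x, y) \<in> edge_pairs \<delta>. x \<in> X \<and> y \<in> X \<and> x \<noteq> y}"
  let ?F = "X \<inter> cball 0 (1 + \<delta> / 2)"
  have "?T \<subseteq> ?F \<times> ?F" using edge_pairs_subset[of \<delta>] by blast
  hence fin: "finite ?T" using assms by (meson finite_SigmaI finite_subset)
  have "(\<Sum>\<^sub>\<infinity>(x, y) \<in> {(x, y). x \<in> X \<and> y \<in> X \<and> x \<noteq> y}.
      of_bool (norm (x - y) \<le> \<delta> \<and> (x + y) /\<^sub>R 2 \<in> cball 0 1)) = (\<Sum>\<^sub>\<infinity>p\<in>?T. 1 :: real)"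
    by (rule infsum_cong_neutral) (auto simp: edge_pairs_def)
  thus ?thesis using fin by (simp add: edge_count_def)
qed

section \<open>The neighbours of a point and their volume\<close>

lemma section_subset_cball: "{y. (x, y) \<in> edge_pairs \<delta>} \<subseteq> cball x \<delta>"
  by (auto simp: edge_pairs_def dist_norm)

text \<open>The midpoint is within \<open>\<delta> / 2\<close> of \<open>x\<close>, so for such
  \<open>x\<close> the midpoint condition follows from the distance condition.\<close>

lemma section_eq_cball:
  assumes "norm x \<le> 1 - \<delta> / 2"
  shows "{y. (x, y) \<in> edge_pairs \<delta>} = cball x \<delta>"
proof -
  have "norm ((x + y) /\<^sub>R 2) \<le> 1" if "norm (x - y) \<le> \<delta>" for y
  proof -
    have "(x + y) /\<^sub>R 2 = x - (x - y) /\<^sub>R 2" by (simp add: algebra_simps flip: scaleR_add_left)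
    hence "norm ((x + y) /\<^sub>R 2) \<le> norm x + norm ((x - y) /\<^sub>R 2)" using norm_triangle_ineq4 by metis
    thus ?thesis using that assms by simp
  qed
  thus ?thesis by (auto simp: edge_pairs_def dist_norm)
qed

lemma section_eq_empty: "norm x > 1 + \<delta> / 2 \<Longrightarrow> {y. (x, y) \<in> edge_pairs \<delta>} = {}"
  using edge_pairs_norm by fastforce

lemma emeasure_section_finite:
  "emeasure lborel {y. (x, y) \<in> edge_pairs \<delta>} < \<infinity>"
proof -
  have "emeasure lborel {y. (x, y) \<in> edge_pairs \<delta>} \<le> emeasure lborel (cball x \<delta>)"
    by (intro emeasure_mono section_subset_cball) simp
  thus ?thesis using emeasure_lborel_cball_finite by (rule order_le_less_trans)
qed

lemma borel_edge_pairs [measurable]: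
  "edge_pairs \<delta> \<in> sets (borel \<Otimes>\<^sub>M borel :: ('a::euclidean_space \<times> 'a) measure)"
  unfolding borel_prod by (rule borel_closed[OF closed_edge_pairs])

lemma measurable_section_edge_pairs:
  "(\<lambda>x::'a::euclidean_space. measure lborel {y. (x, y) \<in> edge_pairs \<delta>}) \<in> borel_measurable borel"
proof -
  have "(edge_pairs \<delta> :: ('a \<times> 'a) set) \<in> sets (borel \<Otimes>\<^sub>M lborel)"
    using borel_edge_pairs by (simp cong: sets_pair_measure_cong)
  hence "(\<lambda>x::'a. emeasure lborel (Pair x -` edge_pairs \<delta>)) \<in> borel_measurable borel"
    by (rule lborel.measurable_emeasure_Pair)
  thus ?thesis by (simp add: measure_def vimage_def)
qed

text \<open>In the coordinates given by the midpoint and the difference of the two endpoints, the set of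
  edges is a product of two balls.\<close>

lemma has_bochner_integral_measure_section:
  fixes \<delta> :: real
  assumes "0 \<le> \<delta>"
  shows "has_bochner_integral lborel (\<lambda>x::'a::euclidean_space. measure lborel {y. (x, y) \<in> edge_pairs \<delta>})
    (unit_ball_vol (DIM('a)) ^ 2 * \<delta> ^ DIM('a))"
proof -
  let ?\<kappa> = "unit_ball_vol (DIM('a))"
  \<comment> \<open>Written as a difference, the midpoint condition says that \<open>x\<close> lies
    in the unit ball centred at \<open>(- u) /\<^sub>R 2\<close>.\<close>
  have mid: "(x + (x + u)) /\<^sub>R 2 = x - (- u) /\<^sub>R 2" for x u :: 'a
    by (simp add: algebra_simps flip: scaleR_add_left)
  have "(\<integral>\<^sup>+x. ennreal (measure lborel {y::'a. (x, y) \<in> edge_pairs \<delta>}) \<partial>lborel)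
      = (\<integral>\<^sup>+x. (\<integral>\<^sup>+y. indicator (edge_pairs \<delta>) (x :: 'a, y) \<partial>lborel) \<partial>lborel)"
  proof (rule nn_integral_cong)
    fix x :: 'a
    have [simp]: "{y. (x, y) \<in> edge_pairs \<delta>} \<in> sets borel"
      using measurable_sets[OF measurable_Pair1'[of x borel borel] borel_edge_pairs[of \<delta>]]
      by (simp add: vimage_def)
    have "ennreal (measure lborel {y. (x, y) \<in> edge_pairs \<delta>}) = emeasure lborel {y. (x, y) \<in> edge_pairs \<delta>}"
      using emeasure_section_finite[of x \<delta>] by (simp add: emeasure_eq_ennreal_measure)
    also have "\<dots> = (\<integral>\<^sup>+y. indicator {y. (x, y) \<in> edge_pairs \<delta>} y \<partial>lborel)"
      by simp
    also have "\<dots> = (\<integral>\<^sup>+y. indicator (edge_pairs \<delta>) (x, y) \<partial>lborel)"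
      by (intro nn_integral_cong) (simp add: indicator_def)
    finally show "ennreal (measure lborel {y. (x, y) \<in> edge_pairs \<delta>})
        = (\<integral>\<^sup>+y. indicator (edge_pairs \<delta>) (x, y) \<partial>lborel)" .
  qed
  \<comment> \<open>Translation invariance replaces \<open>y\<close> by the difference
    \<open>u = y - x\<close>.\<close>
  also have "\<dots> = (\<integral>\<^sup>+x. (\<integral>\<^sup>+u. indicator (edge_pairs \<delta>) (x :: 'a, x + u) \<partial>lborel) \<partial>lborel)"
  proof (rule nn_integral_cong)
    fix x :: 'a
    have "(\<integral>\<^sup>+y. indicator (edge_pairs \<delta>) (x, y) \<partial>distr lborel borel ((+) x))
        = (\<integral>\<^sup>+u. indicator (edge_pairs \<delta>) (x, x + u) \<partial>lborel)"
      by (rule nn_integral_distr) measurable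
    thus "(\<integral>\<^sup>+y. indicator (edge_pairs \<delta>) (x, y) \<partial>lborel)
        = (\<integral>\<^sup>+u. indicator (edge_pairs \<delta>) (x, x + u) \<partial>lborel)"
      by (simp only: lborel_distr_plus)
  qed
  \<comment> \<open>After Tonelli, \<open>x\<close> ranges for fixed \<open>u\<close> over a
    translate of the unit ball, whose volume does not depend on \<open>u\<close>.\<close>
  also have "\<dots> = (\<integral>\<^sup>+u. (\<integral>\<^sup>+x. indicator (edge_pairs \<delta>) (x :: 'a, x + u) \<partial>lborel) \<partial>lborel)"
    by (rule lborel_pair.Fubini') measurable
  also have "\<dots> = (\<integral>\<^sup>+u. (\<integral>\<^sup>+x. indicator (cball 0 \<delta>) (u :: 'a) * indicator (cball ((- u) /\<^sub>R 2) 1) x \<partial>lborel) \<partial>lborel)"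
  proof (intro nn_integral_cong)
    fix u x :: 'a
    have "(x, x + u) \<in> edge_pairs \<delta> \<longleftrightarrow> u \<in> cball 0 \<delta> \<and> x \<in> cball ((- u) /\<^sub>R 2) 1"
      by (simp only: edge_pairs_def mem_Collect_eq prod.case mid)
        (use norm_minus_cancel[of "x + (1/2) *\<^sub>R u"] in \<open>simp add: dist_norm norm_minus_commute\<close>)
    thus "indicator (edge_pairs \<delta>) (x, x + u)
        = (indicator (cball 0 \<delta>) u * indicator (cball ((- u) /\<^sub>R 2) 1) x :: ennreal)"
      by (simp add: indicator_def)
  qed
  also have "\<dots> = (\<integral>\<^sup>+u. ennreal ?\<kappa> * indicator (cball 0 \<delta>) (u :: 'a) \<partial>lborel)"
  proof (intro nn_integral_cong)
    fix u :: 'a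
    have "(\<integral>\<^sup>+x. indicator (cball ((- u) /\<^sub>R 2) 1) x \<partial>lborel) = ennreal ?\<kappa>"
      by (subst nn_integral_indicator) (simp_all add: emeasure_cball del: scaleR_minus_right)
    thus "(\<integral>\<^sup>+x. indicator (cball 0 \<delta>) u * indicator (cball ((- u) /\<^sub>R 2) 1) x \<partial>lborel)
        = ennreal ?\<kappa> * indicator (cball 0 \<delta>) u"
      by (cases "u \<in> cball 0 \<delta>") (simp_all del: scaleR_minus_right)
  qed
  also have "\<dots> = ennreal ?\<kappa> * ennreal (?\<kappa> * \<delta> ^ DIM('a))"
    using assms by (subst nn_integral_cmult_indicator) (simp_all add: emeasure_cball)
  also have "\<dots> = ennreal (?\<kappa> ^ 2 * \<delta> ^ DIM('a))"
    using assms by (simp add: power2_eq_square mult.assoc flip: ennreal_mult)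
  finally show ?thesis
    using assms measurable_section_edge_pairs[of \<delta>, where 'a = 'a]
    by (intro has_bochner_integral_nn_integral) auto
qed

lemma measure_section_le:
  "0 \<le> \<delta> \<Longrightarrow> measure lborel {y. (x, y) \<in> edge_pairs \<delta>}
    \<le> unit_ball_vol (DIM('a)) * \<delta> ^ DIM('a) * indicator (cball 0 (1 + \<delta> / 2)) (x :: 'a::euclidean_space)"
proof (cases "x \<in> cball 0 (1 + \<delta> / 2)")
  case True
  assume "0 \<le> \<delta>"
  have "measure lborel {y. (x, y) \<in> edge_pairs \<delta>} \<le> measure lborel (cball x \<delta>)"
    by (intro measure_mono_fmeasurable section_subset_cball)
      (use measurable_sets[OF measurable_Pair1'[of x borel borel] borel_edge_pairs[of \<delta>]]
        emeasure_lborel_cball_finite[of x \<delta>] in \<open>auto simp: vimage_def fmeasurable_def\<close>)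
  thus ?thesis using True \<open>0 \<le> \<delta>\<close> by (simp add: content_cball)
qed (simp add: section_eq_empty)

text \<open>On the inner ball the section is a full ball of radius \<open>\<delta>\<close>. For
  \<open>\<delta> > 2\<close> the inner ball is empty and the left side is zero.\<close>

lemma measure_section_ge:
  "0 \<le> \<delta> \<Longrightarrow> unit_ball_vol (DIM('a)) * \<delta> ^ DIM('a) * indicator (cball 0 (1 - \<delta> / 2)) (x :: 'a::euclidean_space)
    \<le> measure lborel {y. (x, y) \<in> edge_pairs \<delta>}"
  by (cases "x \<in> cball 0 (1 - \<delta> / 2)") (simp_all add: section_eq_cball content_cball)

text \<open>Square the pointwise bounds and integrate: two factors \<kappa> come from the squared
  section volume, the third from the ball of radius \<open>1 - \<delta> / 2\<close> or
  \<open>1 + \<delta> / 2\<close>. The bound \<open>\<delta> \<le> 2\<close> keeps the inner radius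
  nonnegative, as the volume formula requires.\<close>

lemma integral_measure_section_square_bounds:
  fixes \<delta> :: real
  assumes "0 \<le> \<delta>" "\<delta> \<le> 2"
  defines "I \<equiv> integral\<^sup>L lborel (\<lambda>x::'a::euclidean_space. (measure lborel {y. (x, y) \<in> edge_pairs \<delta>})\<^sup>2)"
  shows "(1 - \<delta> / 2) ^ DIM('a) * unit_ball_vol (DIM('a)) ^ 3 * \<delta> ^ (2 * DIM('a)) \<le> I"
    and "I \<le> (1 + \<delta> / 2) ^ DIM('a) * unit_ball_vol (DIM('a)) ^ 3 * \<delta> ^ (2 * DIM('a))"
proof -
  let ?s = "\<lambda>x::'a. measure lborel {y. (x, y) \<in> edge_pairs \<delta>}"
  let ?c = "unit_ball_vol (DIM('a)) * \<delta> ^ DIM('a)"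
  have int: "integrable lborel (\<lambda>x::'a. ?c\<^sup>2 * indicator (cball 0 r) x)" for r
    using emeasure_lborel_cball_finite[of "0::'a" r] by simp
  have val: "integral\<^sup>L lborel (\<lambda>x::'a. ?c\<^sup>2 * indicator (cball 0 r) x)
      = r ^ DIM('a) * unit_ball_vol (DIM('a)) ^ 3 * \<delta> ^ (2 * DIM('a))" if "0 \<le> r" for r
    using that by (simp add: content_cball power_mult_distrib power2_eq_square power3_eq_cube
        power_mult[of \<delta> 2] mult.commute[of 2 "DIM('a)"] power_mult[of \<delta> _ 2])
  have ind: "(indicator S x :: real)\<^sup>2 = indicator S x" for S and x :: 'a
    by (simp add: indicator_def)
  have upper: "(?s x)\<^sup>2 \<le> ?c\<^sup>2 * indicator (cball 0 (1 + \<delta> / 2)) x" for x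
    using power_mono[OF measure_section_le[OF assms(1), of x], of 2]
    by (simp add: power_mult_distrib ind)
  have lower: "?c\<^sup>2 * indicator (cball 0 (1 - \<delta> / 2)) x \<le> (?s x)\<^sup>2" for x
    using power_mono[OF measure_section_ge[OF assms(1), of x], of 2] assms(1)
    by (simp add: power_mult_distrib ind)
  have ints: "integrable lborel (\<lambda>x. (?s x)\<^sup>2)"
    by (rule Bochner_Integration.integrable_bound[OF int[of "1 + \<delta> / 2"]])
      (use measurable_section_edge_pairs[of \<delta>, where 'a = 'a] upper in auto)
  have "I \<le> integral\<^sup>L lborel (\<lambda>x::'a. ?c\<^sup>2 * indicator (cball 0 (1 + \<delta> / 2)) x)"
    unfolding I_def by (intro integral_mono ints int upper)
  thus "I \<le> (1 + \<delta> / 2) ^ DIM('a) * unit_ball_vol (DIM('a)) ^ 3 * \<delta> ^ (2 * DIM('a))"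
    using assms by (simp only: val)
  have "integral\<^sup>L lborel (\<lambda>x::'a. ?c\<^sup>2 * indicator (cball 0 (1 - \<delta> / 2)) x) \<le> I"
    unfolding I_def by (intro integral_mono ints int lower)
  thus "(1 - \<delta> / 2) ^ DIM('a) * unit_ball_vol (DIM('a)) ^ 3 * \<delta> ^ (2 * DIM('a)) \<le> I"
    using assms by (simp only: val)
qed

section \<open>Scaling to the given intensity, and the edge count\<close>

lemma integral_scale_measure_lborel:
  fixes f :: "'a::euclidean_space \<Rightarrow> real"
  assumes "0 \<le> l" "f \<in> borel_measurable borel"
  shows "(\<integral>x. f x \<partial>scale_measure (ennreal l) lborel) = l * (\<integral>x. f x \<partial>lborel)"
proof -
  have "scale_measure (ennreal l) lborel = density lborel (\<lambda>_::'a. ennreal l)"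
    by (rule measure_eqI) (auto simp: emeasure_density_const)
  thus ?thesis using assms by (simp add: integral_density)
qed

theorem mainTheorem2:
  fixes \<delta> lam :: "nat \<Rightarrow> real"
    and d :: nat
    and M :: "'w measure"
    and \<eta> :: "'w \<Rightarrow> (real ^ 'n) set"
  assumes "\<And>k. k \<ge> 1 \<Longrightarrow> \<delta> k = 1 / real k"
    and "\<And>k. k \<ge> 1 \<Longrightarrow> lam k > 0"
    and "filterlim (\<lambda>k. unit_ball_vol (real k) ^ 2 * lam k ^ 2 * \<delta> k ^ k) at_top sequentially"
    and "d = CARD('n)"
    and "stationary_poisson_process M (lam d) \<eta>"
  shows "prob_space.expectation M (\<lambda>\<omega>. edge_count (\<delta> d) (\<eta> \<omega>))
           = 1/2 * unit_ball_vol (real d) ^ 2 * lam d ^ 2 * \<delta> d ^ d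
         \<and> 1/2 * unit_ball_vol (real d) ^ 2 * lam d ^ 2 * \<delta> d ^ d
             + (1 - \<delta> d / 2) ^ d * unit_ball_vol (real d) ^ 3 * lam d ^ 3 * \<delta> d ^ (2 * d)
           \<le> prob_space.variance M (\<lambda>\<omega>. edge_count (\<delta> d) (\<eta> \<omega>))
         \<and> prob_space.variance M (\<lambda>\<omega>. edge_count (\<delta> d) (\<eta> \<omega>))
           \<le> 1/2 * unit_ball_vol (real d) ^ 2 * lam d ^ 2 * \<delta> d ^ d
             + (1 + \<delta> d / 2) ^ d * unit_ball_vol (real d) ^ 3 * lam d ^ 3 * \<delta> d ^ (2 * d)"
proof -
  let ?l = "lam d" and ?\<delta> = "\<delta> d" and ?\<kappa> = "unit_ball_vol (real d)"
  let ?\<mu> = "scale_measure (ennreal ?l) (lborel :: (real ^ 'n) measure)"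
  let ?s = "\<lambda>x :: real ^ 'n. measure lborel {y. (x, y) \<in> edge_pairs ?\<delta>}"
  let ?N = "\<lambda>\<omega>. real (card {(x, y) \<in> edge_pairs ?\<delta>. x \<in> \<eta> \<omega> \<and> y \<in> \<eta> \<omega> \<and> x \<noteq> y})"
  have P: "poisson_process M ?\<mu> \<eta>"
    using assms(5) by (simp add: stationary_poisson_process_def)
  then interpret prob_space M unfolding poisson_process_def by blast
  \<comment> \<open>An index type is nonempty, so \<open>d\<close> is at least 1 and the assumptions
    on \<open>\<delta>\<close> and \<open>lam\<close> apply at \<open>d\<close>.\<close>
  have d: "1 \<le> d" "DIM(real ^ 'n) = d"
    using assms(4) by (simp_all add: Suc_le_eq)
  have l: "0 \<le> ?l" using assms(2)[OF d(1)] by simp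
  have \<delta>: "0 \<le> ?\<delta>" "?\<delta> \<le> 2"
    using d(1) by (simp_all add: assms(1)[OF d(1)] divide_le_eq)
  have finB: "emeasure ?\<mu> (cball 0 (1 + ?\<delta> / 2)) < \<infinity>"
    using emeasure_lborel_cball_finite[of "0 :: real ^ 'n" "1 + ?\<delta> / 2"]
    by (simp add: ennreal_mult_less_top)
  have mom: "expectation ?N = (\<integral>x. measure ?\<mu> {y. (x, y) \<in> edge_pairs ?\<delta>} \<partial>?\<mu>)"
    "variance ?N = 2 * (\<integral>x. measure ?\<mu> {y. (x, y) \<in> edge_pairs ?\<delta>} \<partial>?\<mu>)
        + 4 * (\<integral>x. (measure ?\<mu> {y. (x, y) \<in> edge_pairs ?\<delta>})\<^sup>2 \<partial>?\<mu>)"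
    using poisson_pair_count_moments[OF P _ closed_edge_pairs edge_pairs_sym edge_pairs_subset
        compact_cball finB] by simp_all
  \<comment> \<open>One factor of the intensity comes from the section and one from the outer
    integral; squaring the section in \<open>I2\<close> adds a third.\<close>
  have I1: "(\<integral>x. measure ?\<mu> {y. (x, y) \<in> edge_pairs ?\<delta>} \<partial>?\<mu>) = ?\<kappa>\<^sup>2 * ?l\<^sup>2 * ?\<delta> ^ d"
    using has_bochner_integral_measure_section[OF \<delta>(1), where 'a = "real ^ 'n"] l
      measurable_section_edge_pairs[of ?\<delta>, where 'a = "real ^ 'n"]
    by (simp add: integral_scale_measure_lborel has_bochner_integral_iff assms(4) power2_eq_square)
  have I2: "(\<integral>x. (measure ?\<mu> {y. (x, y) \<in> edge_pairs ?\<delta>})\<^sup>2 \<partial>?\<mu>)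
      = ?l ^ 3 * integral\<^sup>L lborel (\<lambda>x. (?s x)\<^sup>2)"
    using l measurable_section_edge_pairs[of ?\<delta>, where 'a = "real ^ 'n"]
    by (simp add: integral_scale_measure_lborel power_mult_distrib)
      (simp add: power2_eq_square power3_eq_cube)
  have edge: "edge_count ?\<delta> (\<eta> \<omega>) = 1/2 * ?N \<omega>" if "\<omega> \<in> space M" for \<omega>
    using P that bounded_cball unfolding poisson_process_def by (intro edge_count_eq_card) blast
  have E: "expectation (\<lambda>\<omega>. edge_count ?\<delta> (\<eta> \<omega>)) = 1/2 * expectation ?N"
  proof -
    have "expectation (\<lambda>\<omega>. edge_count ?\<delta> (\<eta> \<omega>)) = expectation (\<lambda>\<omega>. 1/2 * ?N \<omega>)"
      by (intro Bochner_Integration.integral_cong edge refl)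
    thus ?thesis by simp
  qed
  \<comment> \<open>Halving the ordered count divides the variance by 4, turning its coefficients 2
    and 4 into 1/2 and 1.\<close>
  have V: "variance (\<lambda>\<omega>. edge_count ?\<delta> (\<eta> \<omega>)) = 1/4 * variance ?N"
  proof -
    have "variance (\<lambda>\<omega>. edge_count ?\<delta> (\<eta> \<omega>)) = expectation (\<lambda>\<omega>. 1/4 * (?N \<omega> - expectation ?N)\<^sup>2)"
      unfolding E
      by (intro Bochner_Integration.integral_cong refl) (simp add: edge power2_eq_square field_simps)
    thus ?thesis by simp
  qed
  have var: "variance (\<lambda>\<omega>. edge_count ?\<delta> (\<eta> \<omega>))
      = 1/2 * ?\<kappa>\<^sup>2 * ?l\<^sup>2 * ?\<delta> ^ d + ?l ^ 3 * integral\<^sup>L lborel (\<lambda>x. (?s x)\<^sup>2)"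
    unfolding V mom(2) I1 I2 by simp
  note b = integral_measure_section_square_bounds[OF \<delta>, where 'a = "real ^ 'n", unfolded d(2)]
  have "(1 - ?\<delta> / 2) ^ d * ?\<kappa> ^ 3 * ?l ^ 3 * ?\<delta> ^ (2 * d) \<le> ?l ^ 3 * integral\<^sup>L lborel (\<lambda>x. (?s x)\<^sup>2)"
    using mult_left_mono[OF b(1), of "?l ^ 3"] l by (simp add: mult_ac)
  moreover have "?l ^ 3 * integral\<^sup>L lborel (\<lambda>x. (?s x)\<^sup>2) \<le> (1 + ?\<delta> / 2) ^ d * ?\<kappa> ^ 3 * ?l ^ 3 * ?\<delta> ^ (2 * d)"
    using mult_left_mono[OF b(2), of "?l ^ 3"] l by (simp add: mult_ac)
  ultimately show ?thesis unfolding var unfolding E mom(1) I1 by simp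
qed

end
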